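(* Let $p$ and $q$ be distinct primes with $pq\neq 6$ and $q\mid p-1$. Let $r$ be an integer with $r^{q}\equiv 1 \pmod{p}$ and $r\not\equiv 1\pmod{p}$, and let $G=\langle a,b,c\mid a^{q^{2}}=b^{p}=c^{p}=[b,c]=1,\ a^{-1}ba=b^{r},\ a^{-1}ca=c^{r}\rangle$. Then $\mathrm{Aut}(G)\simeq(\mathbb{Z}_{p}\times\mathbb{Z}_{p})\rtimes(GL(2,p)\times\mathbb{Z}_{q})$.
   Context: $\mathbb{Z}_n$ is the cyclic group of order $n$; $[x,y]=x^{-1}y^{-1}xy$. $X\rtimes Y$ denotes a semidirect product with normal subgroup $X$ with respect to some homomorphism $Y\to\mathrm{Aut}(X)$; the statement asserts that $\mathrm{Aut}(G)$ is isomorphic to such a semidirect product for some choice of action. *)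

theory Defs
  imports "HOL-Algebra.Bij" "HOL-Algebra.Elementary_Groups" "HOL-Number_Theory.Residues"
begin

section \<open>Free groups and presentations\<close>

text \<open>A letter \<open>(x, True)\<close> stands for the generator \<open>x\<close> and \<open>(x, False)\<close> for its formal inverse.\<close>

type_synonym 'x word = "('x \<times> bool) list"

inductive word_eq :: "'x word \<Rightarrow> 'x word \<Rightarrow> bool" where
  word_eq_refl: "word_eq w w"
| word_eq_sym: "word_eq v w \<Longrightarrow> word_eq w v"
| word_eq_trans: "word_eq u v \<Longrightarrow> word_eq v w \<Longrightarrow> word_eq u w"
| word_eq_cancel: "word_eq (u @ [(x, e), (x, \<not> e)] @ v) (u @ v)"

definition word_rel :: "'x word rel" where
  "word_rel = {(u, v). word_eq u v}"

text \<open>The free group on the type \<open>'x\<close> of generators.\<close>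

definition free_group :: "'x word set monoid" where
  "free_group =
     \<lparr>carrier = UNIV // word_rel,
      monoid.mult = (\<lambda>A B. \<Union>u\<in>A. \<Union>v\<in>B. word_rel `` {u @ v}),
      one = word_rel `` {[]}\<rparr>"

definition free_gen :: "'x \<Rightarrow> 'x word set" where
  "free_gen x = word_rel `` {[(x, True)]}"

definition normal_closure :: "('a, 'm) monoid_scheme \<Rightarrow> 'a set \<Rightarrow> 'a set" where
  "normal_closure G S = \<Inter>{N. N \<lhd> G \<and> S \<subseteq> N}"

text \<open>A pair \<open>(u, v)\<close> of elements of the free group is the relation \<open>u = v\<close>.\<close>

definition presented_group :: "('x word set \<times> 'x word set) set \<Rightarrow> 'x word set set monoid" where
  "presented_group R =
     free_group Mod normal_closure free_group
       {u \<otimes>\<^bsub>free_group\<^esub> inv\<^bsub>free_group\<^esub> v | u v. (u, v) \<in> R}"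

definition commutator :: "('a, 'm) monoid_scheme \<Rightarrow> 'a \<Rightarrow> 'a \<Rightarrow> 'a" where
  "commutator G x y = inv\<^bsub>G\<^esub> x \<otimes>\<^bsub>G\<^esub> inv\<^bsub>G\<^esub> y \<otimes>\<^bsub>G\<^esub> x \<otimes>\<^bsub>G\<^esub> y"

datatype gen = GenA | GenB | GenC

definition G_relations :: "nat \<Rightarrow> nat \<Rightarrow> int \<Rightarrow> (gen word set \<times> gen word set) set" where
  "G_relations p q r =
    (let F = free_group; a = free_gen GenA; b = free_gen GenB; c = free_gen GenC in
     {(a [^]\<^bsub>F\<^esub> (q ^ 2), \<one>\<^bsub>F\<^esub>),
      (b [^]\<^bsub>F\<^esub> p, \<one>\<^bsub>F\<^esub>),
      (c [^]\<^bsub>F\<^esub> p, \<one>\<^bsub>F\<^esub>),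
      (commutator F b c, \<one>\<^bsub>F\<^esub>),
      (inv\<^bsub>F\<^esub> a \<otimes>\<^bsub>F\<^esub> b \<otimes>\<^bsub>F\<^esub> a, b [^]\<^bsub>F\<^esub> r),
      (inv\<^bsub>F\<^esub> a \<otimes>\<^bsub>F\<^esub> c \<otimes>\<^bsub>F\<^esub> a, c [^]\<^bsub>F\<^esub> r)})"

definition G_group :: "nat \<Rightarrow> nat \<Rightarrow> int \<Rightarrow> gen word set set monoid" where
  "G_group p q r = presented_group (G_relations p q r)"


section \<open>Semidirect products\<close>

text \<open>\<open>N\<close> is the normal factor and \<open>\<phi>\<close> is meant to be a homomorphism from \<open>H\<close> to \<open>AutoGroup N\<close>.\<close>

definition semidirect_product ::
  "('a, 'm) monoid_scheme \<Rightarrow> ('b, 'n) monoid_scheme \<Rightarrow> ('b \<Rightarrow> 'a \<Rightarrow> 'a) \<Rightarrow> ('a \<times> 'b) monoid" where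
  "semidirect_product N H \<phi> =
     \<lparr>carrier = carrier N \<times> carrier H,
      monoid.mult = (\<lambda>(n, h) (n', h'). (n \<otimes>\<^bsub>N\<^esub> \<phi> h n', h \<otimes>\<^bsub>H\<^esub> h')),
      one = (\<one>\<^bsub>N\<^esub>, \<one>\<^bsub>H\<^esub>)\<rparr>"


section \<open>General linear groups\<close>

text \<open>Square matrices over \<open>R\<close> are functions on index pairs, extensional so that equality is
  entrywise equality.\<close>

definition matrix_monoid :: "nat \<Rightarrow> ('a, 'm) ring_scheme \<Rightarrow> (nat \<times> nat \<Rightarrow> 'a) monoid" where
  "matrix_monoid n R =
     \<lparr>carrier = {..<n} \<times> {..<n} \<rightarrow>\<^sub>E carrier R,
      monoid.mult = (\<lambda>A B. \<lambda>(i, j)\<in>{..<n} \<times> {..<n}. \<Oplus>\<^bsub>R\<^esub>k\<in>{..<n}. A (i, k) \<otimes>\<^bsub>R\<^esub> B (k, j)),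
      one = (\<lambda>(i, j)\<in>{..<n} \<times> {..<n}. if i = j then \<one>\<^bsub>R\<^esub> else \<zero>\<^bsub>R\<^esub>)\<rparr>"

definition GL :: "nat \<Rightarrow> ('a, 'm) ring_scheme \<Rightarrow> (nat \<times> nat \<Rightarrow> 'a) monoid" where
  "GL n R = units_of (matrix_monoid n R)"


section \<open>The constructions yield groups\<close>

lemma equiv_word_rel: "equiv UNIV word_rel"
proof (rule equivI)
  show "refl word_rel" by (rule refl_onI) (simp add: word_rel_def word_eq_refl)
  show "sym word_rel" by (rule symI) (simp add: word_rel_def word_eq_sym)
  show "trans word_rel"
    by (rule transI) (simp add: word_rel_def, erule (1) word_eq_trans)
qed simp

lemma word_eq_append_left: "word_eq v w \<Longrightarrow> word_eq (u @ v) (u @ w)"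
proof (induction rule: word_eq.induct)
  case (word_eq_cancel s x e t)
  show ?case using word_eq.word_eq_cancel[of "u @ s" x e t] by simp
qed (simp_all only: word_eq_refl word_eq_sym, erule (1) word_eq_trans)

lemma word_eq_append_right: "word_eq v w \<Longrightarrow> word_eq (v @ u) (w @ u)"
proof (induction rule: word_eq.induct)
  case (word_eq_cancel s x e t)
  show ?case using word_eq.word_eq_cancel[of s x e "t @ u"] by simp
qed (simp_all only: word_eq_refl word_eq_sym, erule (1) word_eq_trans)

lemma word_eq_append: "word_eq u u' \<Longrightarrow> word_eq v v' \<Longrightarrow> word_eq (u @ v) (u' @ v')"
  by (meson word_eq_append_left word_eq_append_right word_eq_trans)

lemma word_class_eq_iff: "word_rel `` {u} = word_rel `` {v} \<longleftrightarrow> word_eq u v"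
  using eq_equiv_class_iff[OF equiv_word_rel, of u v] by (simp add: word_rel_def)

lemma free_group_mult_class [simp]:
  "word_rel `` {u} \<otimes>\<^bsub>free_group\<^esub> word_rel `` {v} = word_rel `` {u @ v}"
proof -
  define A B where "A = word_rel `` {u}" and "B = word_rel `` {v}"
  have "word_rel `` {u' @ v'} = word_rel `` {u @ v}" if "u' \<in> A" "v' \<in> B" for u' v'
    unfolding word_class_eq_iff
    by (rule word_eq_sym, rule word_eq_append)
      (use that in \<open>simp_all add: A_def B_def word_rel_def\<close>)
  then have "(\<Union>u'\<in>A. \<Union>v'\<in>B. word_rel `` {u' @ v'}) = (\<Union>u'\<in>A. \<Union>v'\<in>B. word_rel `` {u @ v})"
    by (intro SUP_cong refl)
  moreover have "A \<noteq> {}" "B \<noteq> {}"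
    by (auto simp: A_def B_def word_rel_def intro: word_eq_refl)
  ultimately show ?thesis
    by (simp add: free_group_def flip: A_def B_def)
qed

lemma free_group_cases:
  assumes "x \<in> carrier free_group" obtains w where "x = word_rel `` {w}"
  using assms unfolding free_group_def by (auto elim: quotientE)

lemma word_class_in_free_group [simp]: "word_rel `` {w} \<in> carrier free_group"
  by (simp add: free_group_def quotientI)

lemma one_free_group: "\<one>\<^bsub>free_group\<^esub> = word_rel `` {[]}"
  by (simp add: free_group_def)

lemma word_eq_inverse: "word_eq (rev (map (\<lambda>(x, e). (x, \<not> e)) w) @ w) []"
proof (induction w)
  case (Cons l w)
  obtain x e where "l = (x, e)" by force
  then show ?case
    using word_eq_trans[OF word_eq_cancel[of "rev (map (\<lambda>(x, e). (x, \<not> e)) w)" x "\<not> e" w] Cons.IH]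
    by simp
qed (auto intro: word_eq_refl)

lemma group_free_group: "group free_group"
proof (rule groupI)
  fix x :: "'a word set"
  assume "x \<in> carrier free_group"
  then obtain w where w: "x = word_rel `` {w}" by (rule free_group_cases)
  show "\<exists>y\<in>carrier free_group. y \<otimes>\<^bsub>free_group\<^esub> x = \<one>\<^bsub>free_group\<^esub>"
    by (rule bexI[of _ "word_rel `` {rev (map (\<lambda>(x, e). (x, \<not> e)) w)}"])
      (simp_all add: w one_free_group word_class_eq_iff word_eq_inverse)
qed (auto elim!: free_group_cases simp: one_free_group)

lemma (in group) normal_normal_closure:
  assumes "S \<subseteq> carrier G" shows "normal_closure G S \<lhd> G"
proof -
  let ?\<N> = "{N. N \<lhd> G \<and> S \<subseteq> N}"
  have "carrier G \<lhd> G"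
    by (simp add: normal_inv_iff subgroup_self)
  then have ne: "?\<N> \<noteq> {}" using assms by blast
  have "subgroup (\<Inter>?\<N>) G"
    by (rule subgroups_Inter) (use ne in \<open>auto simp: normal_imp_subgroup\<close>)
  then show ?thesis
    by (auto simp: normal_closure_def normal_inv_iff)
qed

lemma group_presented_group:
  assumes "R \<subseteq> carrier free_group \<times> carrier free_group"
  shows "group (presented_group R)"
proof -
  interpret F: group "free_group :: 'a word set monoid" by (rule group_free_group)
  show ?thesis
    unfolding presented_group_def
    by (rule normal.factorgroup_is_group, rule F.normal_normal_closure) (use assms in auto)
qed

lemma group_G_group: "group (G_group p q r)"
proof -
  interpret F: group "free_group :: gen word set monoid" by (rule group_free_group)
  have "free_gen x \<in> carrier free_group" for x :: gen
    by (simp add: free_gen_def)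
  then show ?thesis
    unfolding G_group_def
    by (intro group_presented_group) (auto simp: G_relations_def Let_def commutator_def)
qed

lemma group_semidirect_product:
  assumes "group N" "group H" "\<phi> \<in> hom H (AutoGroup N)"
  shows "group (semidirect_product N H \<phi>)"
proof -
  interpret N: group N by fact
  interpret H: group H by fact
  interpret A: group "AutoGroup N" by (rule N.AutoGroup)
  interpret phi: group_hom H "AutoGroup N" \<phi>
    by unfold_locales (rule assms(3))
  have car: "carrier (AutoGroup N) = auto N" by (simp add: AutoGroup_def)
  have aut: "\<phi> h \<in> auto N" if "h \<in> carrier H" for h
    using phi.hom_closed[OF that] by (simp add: car)
  have cl [simp]: "\<phi> h n \<in> carrier N" if "h \<in> carrier H" "n \<in> carrier N" for h n
    using aut[OF that(1)] that(2) by (auto simp: auto_def hom_def)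
  have mul: "\<phi> h (n \<otimes>\<^bsub>N\<^esub> n') = \<phi> h n \<otimes>\<^bsub>N\<^esub> \<phi> h n'"
    if "h \<in> carrier H" "n \<in> carrier N" "n' \<in> carrier N" for h n n'
    using aut[OF that(1)] that by (auto simp: auto_def hom_def)
  have comp: "\<phi> (h \<otimes>\<^bsub>H\<^esub> h') n = \<phi> h (\<phi> h' n)"
    if "h \<in> carrier H" "h' \<in> carrier H" "n \<in> carrier N" for h h' n
    using phi.hom_mult[OF that(1,2)] aut[OF that(1)] aut[OF that(2)] that(3)
    by (simp add: AutoGroup_def BijGroup_def auto_def compose_def)
  have one: "\<phi> \<one>\<^bsub>H\<^esub> n = n" if "n \<in> carrier N" for n
    using phi.hom_one that by (simp add: AutoGroup_def BijGroup_def)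
  show ?thesis
  proof (rule groupI)
    fix x assume "x \<in> carrier (semidirect_product N H \<phi>)"
    then obtain n h where x: "x = (n, h)" "n \<in> carrier N" "h \<in> carrier H"
      by (auto simp: semidirect_product_def)
    define k where "k = inv\<^bsub>H\<^esub> h"
    have k: "k \<in> carrier H" "k \<otimes>\<^bsub>H\<^esub> h = \<one>\<^bsub>H\<^esub>" using x by (simp_all add: k_def)
    have "\<phi> k \<one>\<^bsub>N\<^esub> \<otimes>\<^bsub>N\<^esub> \<phi> k \<one>\<^bsub>N\<^esub> = \<phi> k \<one>\<^bsub>N\<^esub>"
      using mul[of k "\<one>\<^bsub>N\<^esub>" "\<one>\<^bsub>N\<^esub>"] k(1) by simp
    then have "\<phi> k \<one>\<^bsub>N\<^esub> = \<one>\<^bsub>N\<^esub>"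
      using k(1) by (simp add: N.l_cancel_one')
    then have "\<phi> k (inv\<^bsub>N\<^esub> n) \<otimes>\<^bsub>N\<^esub> \<phi> k n = \<one>\<^bsub>N\<^esub>"
      using mul[of k "inv\<^bsub>N\<^esub> n" n] k(1) x by simp
    then show "\<exists>y\<in>carrier (semidirect_product N H \<phi>).
        y \<otimes>\<^bsub>semidirect_product N H \<phi>\<^esub> x = \<one>\<^bsub>semidirect_product N H \<phi>\<^esub>"
      using x k by (intro bexI[of _ "(\<phi> k (inv\<^bsub>N\<^esub> n), k)"]) (simp_all add: semidirect_product_def)
  qed (auto simp: semidirect_product_def mul comp one N.m_assoc H.m_assoc
      simp del: phi.hom_mult phi.hom_one)
qed

lemma (in abelian_monoid) finsum_swap:
  assumes "finite A" "finite B" "\<And>i j. i \<in> A \<Longrightarrow> j \<in> B \<Longrightarrow> f i j \<in> carrier G"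
  shows "(\<Oplus>i\<in>A. \<Oplus>j\<in>B. f i j) = (\<Oplus>j\<in>B. \<Oplus>i\<in>A. f i j)"
  using assms(1,3)
proof (induction A rule: finite_induct)
  case (insert a A)
  have "(\<Oplus>i\<in>insert a A. \<Oplus>j\<in>B. f i j) = (\<Oplus>j\<in>B. f a j) \<oplus> (\<Oplus>i\<in>A. \<Oplus>j\<in>B. f i j)"
    using insert.hyps insert.prems by (intro finsum_insert) (auto intro!: finsum_closed)
  also have "(\<Oplus>i\<in>A. \<Oplus>j\<in>B. f i j) = (\<Oplus>j\<in>B. \<Oplus>i\<in>A. f i j)"
    by (rule insert.IH) (simp add: insert.prems)
  also have "(\<Oplus>j\<in>B. f a j) \<oplus> (\<Oplus>j\<in>B. \<Oplus>i\<in>A. f i j) = (\<Oplus>j\<in>B. f a j \<oplus> (\<Oplus>i\<in>A. f i j))"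
    using insert.prems by (intro finsum_addf[symmetric]) (auto intro!: finsum_closed)
  also have "\<dots> = (\<Oplus>j\<in>B. \<Oplus>i\<in>insert a A. f i j)"
    using insert.hyps insert.prems by (intro finsum_cong') (auto intro!: finsum_closed)
  finally show ?case .
qed (simp add: finsum_zero)

lemma (in ring) monoid_matrix_monoid: "monoid (matrix_monoid n R)"
proof (rule monoidI)
  fix A B C
  assume car: "A \<in> carrier (matrix_monoid n R)" "B \<in> carrier (matrix_monoid n R)"
    "C \<in> carrier (matrix_monoid n R)"
  have mem [simp]: "A (i, j) \<in> carrier R" "B (i, j) \<in> carrier R" "C (i, j) \<in> carrier R"
    if "i < n" "j < n" for i j
    using car that by (auto simp: matrix_monoid_def PiE_iff)
  have "(\<Oplus>k\<in>{..<n}. (\<Oplus>l\<in>{..<n}. A (i, l) \<otimes> B (l, k)) \<otimes> C (k, j)) =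
        (\<Oplus>l\<in>{..<n}. A (i, l) \<otimes> (\<Oplus>k\<in>{..<n}. B (l, k) \<otimes> C (k, j)))"
    if ij: "i < n" "j < n" for i j
  proof -
    have "(\<Oplus>k\<in>{..<n}. (\<Oplus>l\<in>{..<n}. A (i, l) \<otimes> B (l, k)) \<otimes> C (k, j)) =
          (\<Oplus>k\<in>{..<n}. \<Oplus>l\<in>{..<n}. A (i, l) \<otimes> B (l, k) \<otimes> C (k, j))"
      by (rule finsum_cong') (auto simp: ij Pi_iff finsum_ldistr)
    also have "\<dots> = (\<Oplus>l\<in>{..<n}. \<Oplus>k\<in>{..<n}. A (i, l) \<otimes> B (l, k) \<otimes> C (k, j))"
      by (rule finsum_swap) (auto simp: ij)
    also have "\<dots> = (\<Oplus>l\<in>{..<n}. A (i, l) \<otimes> (\<Oplus>k\<in>{..<n}. B (l, k) \<otimes> C (k, j)))"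
      by (rule finsum_cong') (auto simp: ij Pi_iff finsum_rdistr m_assoc intro!: finsum_cong')
    finally show ?thesis .
  qed
  then show "A \<otimes>\<^bsub>matrix_monoid n R\<^esub> B \<otimes>\<^bsub>matrix_monoid n R\<^esub> C =
             A \<otimes>\<^bsub>matrix_monoid n R\<^esub> (B \<otimes>\<^bsub>matrix_monoid n R\<^esub> C)"
    by (auto simp: matrix_monoid_def fun_eq_iff restrict_def cong: finsum_cong)
next
  fix A B
  assume "A \<in> carrier (matrix_monoid n R)" "B \<in> carrier (matrix_monoid n R)"
  then show "A \<otimes>\<^bsub>matrix_monoid n R\<^esub> B \<in> carrier (matrix_monoid n R)"
    unfolding matrix_monoid_def by (auto simp: PiE_iff intro!: finsum_closed)
next
  show "\<one>\<^bsub>matrix_monoid n R\<^esub> \<in> carrier (matrix_monoid n R)"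
    by (auto simp: matrix_monoid_def)
next
  fix A assume car: "A \<in> carrier (matrix_monoid n R)"
  have mem: "A (i, j) \<in> carrier R" if "i < n" "j < n" for i j
    using car that by (auto simp: matrix_monoid_def PiE_iff)
  have out: "A (i, j) = undefined" if "i < n \<longrightarrow> \<not> j < n" for i j
    using car that by (auto simp: matrix_monoid_def PiE_iff extensional_def)
  have l: "(\<Oplus>k\<in>{..<n}. (\<one>\<^bsub>matrix_monoid n R\<^esub>) (i, k) \<otimes> A (k, j)) = A (i, j)"
    if ij: "i < n" "j < n" for i j
  proof -
    have "(\<Oplus>k\<in>{..<n}. (\<one>\<^bsub>matrix_monoid n R\<^esub>) (i, k) \<otimes> A (k, j)) =
          (\<Oplus>k\<in>{..<n}. if i = k then A (k, j) else \<zero>)"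
      by (rule finsum_cong') (use ij in \<open>auto simp: matrix_monoid_def mem\<close>)
    also have "\<dots> = A (i, j)"
      by (rule finsum_singleton) (use ij in \<open>auto simp: mem\<close>)
    finally show ?thesis .
  qed
  have r: "(\<Oplus>k\<in>{..<n}. A (i, k) \<otimes> (\<one>\<^bsub>matrix_monoid n R\<^esub>) (k, j)) = A (i, j)"
    if ij: "i < n" "j < n" for i j
  proof -
    have "(\<Oplus>k\<in>{..<n}. A (i, k) \<otimes> (\<one>\<^bsub>matrix_monoid n R\<^esub>) (k, j)) =
          (\<Oplus>k\<in>{..<n}. if j = k then A (i, k) else \<zero>)"
      by (rule finsum_cong') (use ij in \<open>auto simp: matrix_monoid_def mem\<close>)
    also have "\<dots> = A (i, j)"
      by (rule finsum_singleton) (use ij in \<open>auto simp: mem\<close>)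
    finally show ?thesis .
  qed
  have mult: "P \<otimes>\<^bsub>matrix_monoid n R\<^esub> Q =
      (\<lambda>(i, j)\<in>{..<n} \<times> {..<n}. \<Oplus>k\<in>{..<n}. P (i, k) \<otimes> Q (k, j))" for P Q
    by (simp add: matrix_monoid_def)
  show "\<one>\<^bsub>matrix_monoid n R\<^esub> \<otimes>\<^bsub>matrix_monoid n R\<^esub> A = A"
    unfolding mult by (rule HOL.ext) (clarsimp simp: restrict_def l out)
  show "A \<otimes>\<^bsub>matrix_monoid n R\<^esub> \<one>\<^bsub>matrix_monoid n R\<^esub> = A"
    unfolding mult by (rule HOL.ext) (clarsimp simp: restrict_def r out)
qed

lemma (in ring) group_GL: "group (GL n R)"
  unfolding GL_def by (rule monoid.units_group[OF monoid_matrix_monoid])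

end

theory Submission
  imports Defs
begin

text \<open>
  The group \<open>G\<close> is an extension of \<open>V = \<langle>b, c\<rangle>\<close>, a plane over the field with \<open>p\<close> elements, by
  the cyclic group \<open>\<langle>a\<rangle>\<close> of order \<open>q\<^sup>2\<close>, where \<open>a\<close> acts on \<open>V\<close> as the scalar \<open>r\<close> of order \<open>q\<close>. The
  elements of \<open>V\<close> are those of order dividing \<open>p\<close>, so an automorphism \<open>f\<close> restricts to some
  \<open>A \<in> GL V\<close> and is then determined by \<open>f a = a\<^sup>k n\<close> with \<open>n \<in> V\<close>. Scalars commute with \<open>A\<close>, so the only
  condition is \<open>r ^ k = r\<close>, that is \<open>k = 1 + q j\<close> with \<open>j\<close> modulo \<open>q\<close>. As \<open>r - 1\<close> is invertible,
  \<open>n = (r - 1) m\<close> for a unique \<open>m \<in> V\<close>, and then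
  \<open>f (a\<^sup>i v) = a ^ (i (1 + q j)) \<cdot> (A v + (r ^ i - 1) m)\<close>.

  The triples \<open>(m, A, j)\<close> compose by \<open>(m', A', j') (m, A, j) = (m' + A' m, A' A, j' + j)\<close>, since
  \<open>(1 + q j) (1 + q j')\<close> is \<open>1 + q (j + j')\<close> modulo \<open>q\<^sup>2\<close>. This is the semidirect product of \<open>V\<close> with
  the product of the general linear group and the cyclic group of order \<open>q\<close>, the latter acting
  trivially on \<open>V\<close>. These steps are \<open>auto_preserves_V\<close>, \<open>auto_is_Phi\<close>, \<open>Phi_mult\<close> and \<open>Aut_model_iso\<close>.

  The computation is carried out in a concrete group of triples \<open>(i, x, y)\<close> that stand for
  \<open>a\<^sup>i b\<^sup>x c\<^sup>y\<close>. That the presentation defines this group, and not a proper quotient or an extension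
  of it, is \<open>G_group_iso_model\<close>: the relations suffice to multiply normal forms, and the concrete
  group satisfies the relations. The isomorphism is carried over to automorphism groups by
  \<open>AutoGroup_cong\<close>.
\<close>

section \<open>Automorphism groups\<close>

lemma autoI:
  assumes "f \<in> hom G G" "f \<in> extensional (carrier G)" "bij_betw f (carrier G) (carrier G)"
  shows "f \<in> auto G"
  using assms by (simp add: auto_def Bij_def)

lemma autoD:
  assumes "f \<in> auto G"
  shows "f \<in> hom G G" "f \<in> extensional (carrier G)" "bij_betw f (carrier G) (carrier G)"
  using assms by (simp_all add: auto_def Bij_def)

lemma carrier_AutoGroup [simp]: "carrier (AutoGroup G) = auto G"
  by (simp add: AutoGroup_def)

lemma one_AutoGroup: "\<one>\<^bsub>AutoGroup G\<^esub> = (\<lambda>x\<in>carrier G. x)"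
  by (simp add: AutoGroup_def BijGroup_def)

lemma mult_AutoGroup:
  assumes "f \<in> auto G" "g \<in> auto G"
  shows "f \<otimes>\<^bsub>AutoGroup G\<^esub> g = compose (carrier G) f g"
  using assms by (simp add: AutoGroup_def BijGroup_def auto_def)

lemma conj_in_auto:
  assumes "group H" and h: "h \<in> hom G H" and k: "k \<in> hom H G"
    and kh: "\<And>x. x \<in> carrier G \<Longrightarrow> k (h x) = x" and hk: "\<And>y. y \<in> carrier H \<Longrightarrow> h (k y) = y"
    and f: "f \<in> auto G"
  shows "(\<lambda>y\<in>carrier H. h (f (k y))) \<in> auto H"
proof (rule autoI)
  note f = autoD[OF f]
  have bh: "bij_betw h (carrier G) (carrier H)"
    by (rule bij_betw_byWitness[of _ k]) (use h k kh hk in \<open>auto simp: hom_def\<close>)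
  have bk: "bij_betw k (carrier H) (carrier G)"
    by (rule bij_betw_byWitness[of _ h]) (use h k kh hk in \<open>auto simp: hom_def\<close>)
  have "bij_betw (h \<circ> (f \<circ> k)) (carrier H) (carrier H)"
    using bij_betw_trans[OF bij_betw_trans[OF bk f(3)] bh] by simp
  then show "bij_betw (\<lambda>y\<in>carrier H. h (f (k y))) (carrier H) (carrier H)"
    by (rule bij_betw_cong[THEN iffD1, rotated]) simp
  show "(\<lambda>y\<in>carrier H. h (f (k y))) \<in> hom H H"
  proof (rule homI)
    fix x y assume xy: "x \<in> carrier H" "y \<in> carrier H"
    have "x \<otimes>\<^bsub>H\<^esub> y \<in> carrier H"
      using xy group.is_monoid[OF \<open>group H\<close>] by (simp add: monoid.m_closed)
    then show "(\<lambda>y\<in>carrier H. h (f (k y))) (x \<otimes>\<^bsub>H\<^esub> y) =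
      (\<lambda>y\<in>carrier H. h (f (k y))) x \<otimes>\<^bsub>H\<^esub> (\<lambda>y\<in>carrier H. h (f (k y))) y"
      using xy h k f(1) by (simp add: hom_def Pi_iff)
  qed (use h k f(1) in \<open>auto simp: hom_def\<close>)
qed simp

text \<open>Conjugation by an isomorphism \<open>G \<rightarrow> H\<close> is the isomorphism of automorphism groups; restriction to
  the carriers keeps the conjugates extensional. This lets automorphisms be computed in a concrete
  copy of a presented group.\<close>

lemma AutoGroup_cong:
  assumes "group G" "group H" "G \<cong> H"
  shows "AutoGroup G \<cong> AutoGroup H"
proof -
  interpret G: group G by fact
  interpret H: group H by fact
  obtain h where h: "h \<in> iso G H" using assms(3) by (auto simp: is_iso_def)
  define k where "k = inv_into (carrier G) h"
  have k: "k \<in> iso H G" unfolding k_def by (rule G.iso_set_sym[OF h])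
  have hh: "h \<in> hom G H" and kk: "k \<in> hom H G" using h k by (auto simp: iso_def)
  have kh: "k (h x) = x" if "x \<in> carrier G" for x
    using h that by (auto simp: k_def iso_def intro: bij_betw_inv_into_left)
  have hk: "h (k y) = y" if "y \<in> carrier H" for y
    using h that by (auto simp: k_def iso_def intro: bij_betw_inv_into_right)
  define T where "T = (\<lambda>f. \<lambda>y\<in>carrier H. h (f (k y)))"
  define S where "S = (\<lambda>f. \<lambda>x\<in>carrier G. k (f (h x)))"
  have T: "T f \<in> auto H" if "f \<in> auto G" for f
    unfolding T_def by (rule conj_in_auto[OF H.group_axioms hh kk kh hk that])
  have S: "S f \<in> auto G" if "f \<in> auto H" for f
    unfolding S_def by (rule conj_in_auto[OF G.group_axioms kk hh hk kh that])
  have clG: "f x \<in> carrier G" if "f \<in> auto G" "x \<in> carrier G" for f x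
    using that by (auto simp: auto_def hom_def)
  have clH: "f y \<in> carrier H" if "f \<in> auto H" "y \<in> carrier H" for f y
    using that by (auto simp: auto_def hom_def)
  note cl = hom_in_carrier[OF hh] hom_in_carrier[OF kk] clG clH
  have "T \<in> hom (AutoGroup G) (AutoGroup H)"
    using T cl
    by (intro homI) (auto simp: mult_AutoGroup T_def compose_def kh intro!: restrict_ext)
  moreover have "bij_betw T (auto G) (auto H)"
  proof (rule bij_betw_byWitness[of _ S])
    show "\<forall>f\<in>auto G. S (T f) = f"
      using cl
      by (auto simp: S_def T_def kh dest: autoD(2) intro!: extensionalityI[of _ "carrier G"])
  next
    show "\<forall>f\<in>auto H. T (S f) = f"
      using cl
      by (auto simp: S_def T_def hk dest: autoD(2) intro!: extensionalityI[of _ "carrier H"])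
  qed (use S T in auto)
  ultimately show ?thesis by (auto simp: is_iso_def iso_def)
qed

text \<open>Endomorphisms suffice: each \<open>F h\<close> is automatically bijective, because the inverse of \<open>h\<close> acts
  as the inverse map.\<close>

lemma hom_into_AutoGroupI:
  assumes "group H"
    and F: "\<And>h. h \<in> carrier H \<Longrightarrow> F h \<in> hom G G" "\<And>h. h \<in> carrier H \<Longrightarrow> F h \<in> extensional (carrier G)"
    and mult: "\<And>h h' x. h \<in> carrier H \<Longrightarrow> h' \<in> carrier H \<Longrightarrow> x \<in> carrier G \<Longrightarrow>
      F (h \<otimes>\<^bsub>H\<^esub> h') x = F h (F h' x)"
    and one: "\<And>x. x \<in> carrier G \<Longrightarrow> F \<one>\<^bsub>H\<^esub> x = x"
  shows "F \<in> hom H (AutoGroup G)"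
proof -
  interpret H: group H by fact
  have cl: "F h x \<in> carrier G" if "h \<in> carrier H" "x \<in> carrier G" for h x
    using F(1) that by (auto simp: hom_def)
  have "bij_betw (F h) (carrier G) (carrier G)" if h: "h \<in> carrier H" for h
  proof (rule bij_betw_byWitness[of _ "F (inv\<^bsub>H\<^esub> h)"])
    show "\<forall>x\<in>carrier G. F (inv\<^bsub>H\<^esub> h) (F h x) = x" "\<forall>x\<in>carrier G. F h (F (inv\<^bsub>H\<^esub> h) x) = x"
      using h by (simp_all add: one flip: mult)
  qed (use cl h in auto)
  then have aut: "F h \<in> auto G" if "h \<in> carrier H" for h
    using that F by (intro autoI)
  show ?thesis
  proof (rule homI)
    fix h h' assume "h \<in> carrier H" "h' \<in> carrier H"
    then show "F (h \<otimes>\<^bsub>H\<^esub> h') = F h \<otimes>\<^bsub>AutoGroup G\<^esub> F h'"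
      by (intro extensionalityI[OF F(2)]) (auto simp: mult_AutoGroup aut compose_def mult)
  qed (simp add: aut)
qed

section \<open>Presented groups\<close>

primrec word_eval :: "('a, 'm) monoid_scheme \<Rightarrow> ('x \<Rightarrow> 'a) \<Rightarrow> 'x word \<Rightarrow> 'a" where
  "word_eval H f [] = \<one>\<^bsub>H\<^esub>"
| "word_eval H f (l # w) =
     (if snd l then f (fst l) else inv\<^bsub>H\<^esub> f (fst l)) \<otimes>\<^bsub>H\<^esub> word_eval H f w"

context group
begin

lemma word_eval_closed [simp]: "range f \<subseteq> carrier G \<Longrightarrow> word_eval G f w \<in> carrier G"
  by (induction w) (auto simp: range_subsetD)

lemma word_eval_append:
  "range f \<subseteq> carrier G \<Longrightarrow> word_eval G f (u @ v) = word_eval G f u \<otimes> word_eval G f v"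
  by (induction u) (auto simp: m_assoc range_subsetD)

lemma word_eval_cong:
  "word_eq u v \<Longrightarrow> range f \<subseteq> carrier G \<Longrightarrow> word_eval G f u = word_eval G f v"
proof (induction rule: word_eq.induct)
  case (word_eq_cancel u x e v)
  then have "f x \<in> carrier G" "word_eval G f v \<in> carrier G" by auto
  then have "f x \<otimes> (inv f x \<otimes> word_eval G f v) = word_eval G f v"
    "inv f x \<otimes> (f x \<otimes> word_eval G f v) = word_eval G f v"
    by (simp_all flip: m_assoc)
  then show ?case using word_eq_cancel by (simp add: word_eval_append)
qed auto


end


text \<open>The extension of a map on generators to the free group; every representing word gives the
  same value, so the choice is harmless.\<close>

definition free_lift :: "('a, 'm) monoid_scheme \<Rightarrow> ('x \<Rightarrow> 'a) \<Rightarrow> 'x word set \<Rightarrow> 'a" where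
  "free_lift H f X = word_eval H f (SOME w. w \<in> X)"

context group
begin

lemma free_lift_class:
  assumes "range f \<subseteq> carrier G"
  shows "free_lift G f (word_rel `` {w}) = word_eval G f w"
proof -
  have "w \<in> word_rel `` {w}" by (simp add: word_rel_def word_eq_refl)
  then have "(SOME v. v \<in> word_rel `` {w}) \<in> word_rel `` {w}" by (rule someI)
  then show ?thesis
    using assms by (simp add: free_lift_def word_rel_def word_eval_cong)
qed

lemma free_lift_gen: "range f \<subseteq> carrier G \<Longrightarrow> free_lift G f (free_gen x) = f x"
  by (simp add: free_gen_def free_lift_class range_subsetD)

lemma free_lift_hom: "range f \<subseteq> carrier G \<Longrightarrow> free_lift G f \<in> hom free_group G"
  by (rule homI) (auto elim!: free_group_cases simp: free_lift_class word_eval_append)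

end

definition relators :: "('x word set \<times> 'x word set) set \<Rightarrow> 'x word set set" where
  "relators R = {u \<otimes>\<^bsub>free_group\<^esub> inv\<^bsub>free_group\<^esub> v | u v. (u, v) \<in> R}"

definition presented_class ::
  "('x word set \<times> 'x word set) set \<Rightarrow> 'x word set \<Rightarrow> 'x word set set" where
  "presented_class R u = normal_closure free_group (relators R) #>\<^bsub>free_group\<^esub> u"

locale presentation =
  fixes R :: "('x word set \<times> 'x word set) set"
  assumes relations_closed: "R \<subseteq> carrier free_group \<times> carrier free_group"
begin

sublocale F: group "free_group :: 'x word set monoid" by (rule group_free_group)

sublocale P: group "presented_group R" by (rule group_presented_group[OF relations_closed])

lemma relators_subset: "relators R \<subseteq> carrier free_group"
  using relations_closed by (auto simp: relators_def)

sublocale K: normal "normal_closure free_group (relators R)" free_group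
  by (rule F.normal_normal_closure[OF relators_subset])

lemma presented_group_eq: "presented_group R = free_group Mod normal_closure free_group (relators R)"
  by (simp add: presented_group_def relators_def)

sublocale pi: group_hom free_group "presented_group R" "presented_class R"
proof unfold_locales
  show "presented_class R \<in> hom free_group (presented_group R)"
    using K.r_coset_hom_Mod unfolding presented_group_eq presented_class_def by simp
qed

lemma presented_class_relation:
  assumes "(u, v) \<in> R"
  shows "presented_class R u = presented_class R v"
proof -
  have uv: "u \<in> carrier free_group" "v \<in> carrier free_group"
    using assms relations_closed by auto
  have "u \<otimes>\<^bsub>free_group\<^esub> inv\<^bsub>free_group\<^esub> v \<in> normal_closure free_group (relators R)"
    using assms by (auto simp: normal_closure_def relators_def)
  then have "u \<in> presented_class R v"
    using uv by (force simp: presented_class_def r_coset_def F.m_assoc)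
  then show ?thesis
    unfolding presented_class_def
    using F.repr_independence[OF _ uv(2) K.subgroup_axioms] by blast
qed

lemma presented_group_generated:
  assumes "subgroup S (presented_group R)" "\<And>x. presented_class R (free_gen x) \<in> S"
  shows "carrier (presented_group R) = S"
proof
  show "S \<subseteq> carrier (presented_group R)" by (rule subgroup.subset[OF assms(1)])
  show "carrier (presented_group R) \<subseteq> S"
  proof
    fix X assume "X \<in> carrier (presented_group R)"
    then obtain u where u: "u \<in> carrier free_group" "X = presented_class R u"
      unfolding presented_group_eq presented_class_def FactGroup_def RCOSETS_def by auto
    obtain w where w: "u = word_rel `` {w}" using u(1) by (rule free_group_cases)
    have "presented_class R (word_rel `` {w}) \<in> S"
    proof (induction w)
      case Nil
      then show ?case
        using pi.hom_one subgroup.one_closed[OF assms(1)] by (simp add: one_free_group)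
    next
      case (Cons l w)
      have g: "free_gen x \<in> carrier free_group" for x :: 'x by (simp add: free_gen_def)
      have i: "inv\<^bsub>free_group\<^esub> free_gen x = word_rel `` {[(x, False)]}" for x :: 'x
        by (rule F.inv_equality)
          (use word_eq_cancel[of "[]" x False "[]"] in
            \<open>simp_all add: free_gen_def one_free_group word_class_eq_iff\<close>)
      have "presented_class R (word_rel `` {[l]}) \<in> S"
      proof (cases l)
        case (Pair x e)
        show ?thesis
        proof (cases e)
          case True
          then show ?thesis using assms(2)[of x] by (simp add: Pair free_gen_def)
        next
          case False
          have "presented_class R (inv\<^bsub>free_group\<^esub> free_gen x) \<in> S"
            using assms g by (simp add: subgroup.m_inv_closed)
          then show ?thesis by (simp add: Pair False i)
        qed
      qed
      then have "presented_class R (word_rel `` {[l]}) \<otimes>\<^bsub>presented_group R\<^esub>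
          presented_class R (word_rel `` {w}) \<in> S"
        using Cons.IH by (rule subgroup.m_closed[OF assms(1)])
      then show ?case by (simp flip: pi.hom_mult)
    qed
    then show "X \<in> S" by (simp add: u w)
  qed
qed

text \<open>The substance of von Dyck's theorem: the kernel of the extended map is a normal subgroup that
  contains the relators, hence it contains their normal closure.\<close>

lemma free_lift_eq_if_presented_class_eq:
  assumes "group H" "range f \<subseteq> carrier H"
    and rel: "\<And>u v. (u, v) \<in> R \<Longrightarrow> free_lift H f u = free_lift H f v"
    and uv: "u \<in> carrier free_group" "v \<in> carrier free_group"
      "presented_class R u = presented_class R v"
  shows "free_lift H f u = free_lift H f v"
proof -
  interpret H: group H by fact
  interpret l: group_hom free_group H "free_lift H f"
    by unfold_locales (rule H.free_lift_hom[OF assms(2)])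
  have "relators R \<subseteq> kernel free_group H (free_lift H f)"
    using rel relations_closed by (fastforce simp: relators_def kernel_def)
  then have sub: "normal_closure free_group (relators R) \<subseteq> kernel free_group H (free_lift H f)"
    unfolding normal_closure_def using l.normal_kernel by blast
  have "u \<in> presented_class R u"
    unfolding presented_class_def by (rule F.rcos_self[OF uv(1) K.subgroup_axioms])
  then obtain n where n: "n \<in> normal_closure free_group (relators R)"
      "u = n \<otimes>\<^bsub>free_group\<^esub> v"
    unfolding uv(3) by (auto simp: presented_class_def r_coset_def)
  then have "n \<in> carrier free_group" "free_lift H f n = \<one>\<^bsub>H\<^esub>"
    using sub by (auto simp: kernel_def)
  then show ?thesis using n(2) uv(2) by simp
qed

end

section \<open>A concrete model\<close>

lemma (in group) nat_pow_mod:
  fixes n m :: nat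
  assumes "x \<in> carrier G" "x [^] n = \<one>"
  shows "x [^] (m mod n) = x [^] m"
proof -
  have "x [^] m = x [^] (n * (m div n) + m mod n)" by simp
  also have "\<dots> = x [^] (n * (m div n)) \<otimes> x [^] (m mod n)"
    using assms by (simp only: nat_pow_mult)
  also have "x [^] (n * (m div n)) = \<one>"
    using assms by (simp flip: nat_pow_pow)
  finally show ?thesis using assms by simp
qed

lemma (in group) int_pow_mod:
  fixes n :: nat and m :: int
  assumes "x \<in> carrier G" "x [^] n = \<one>"
  shows "x [^] (m mod int n) = x [^] m"
proof -
  have "x [^] m = x [^] (int n * (m div int n) + m mod int n)" by simp
  also have "\<dots> = x [^] (int n * (m div int n)) \<otimes> x [^] (m mod int n)"
    using assms by (simp only: int_pow_mult)
  also have "x [^] (int n * (m div int n)) = \<one>"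
    using assms by (simp add: int_pow_int flip: int_pow_pow)
  finally show ?thesis using assms by simp
qed

locale scalar_action =
  fixes p q :: nat and r :: int
  assumes prime_p: "prime p" and prime_q: "prime q" and p_neq_q: "p \<noteq> q"
    and r_pow_q: "[r ^ q = 1] (mod int p)" and r_neq_1: "\<not> [r = 1] (mod int p)"
begin

lemma p_gt_1: "p > 1" and q_gt_1: "q > 1"
  using prime_p prime_q prime_gt_1_nat by blast+

lemma q2_gt: "q ^ 2 > q"
  using q_gt_1 by (simp add: power2_eq_square)

lemma r_pow_mod_q: "[r ^ (n mod q) = r ^ n] (mod int p)"
proof -
  have "r ^ n = (r ^ q) ^ (n div q) * r ^ (n mod q)"
    by (simp flip: power_mult power_add)
  moreover have "[(r ^ q) ^ (n div q) * r ^ (n mod q) = 1 ^ (n div q) * r ^ (n mod q)] (mod int p)"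
    by (intro cong_mult cong_pow r_pow_q cong_refl)
  ultimately show ?thesis by (simp add: cong_sym_eq)
qed

lemma r_pow_cong:
  assumes "[n = m] (mod q)"
  shows "[r ^ n = r ^ m] (mod int p)"
  using assms r_pow_mod_q by (metis cong_def)

lemma r_pow_mod_q2: "[r ^ (n mod q ^ 2) = r ^ n] (mod int p)"
  by (rule r_pow_cong) (simp add: cong_def mod_mod_cancel)

lemma coprime_r: "coprime r (int p)"
proof -
  have "coprime (r ^ q) (int p)"
    using r_pow_q by (metis cong_imp_coprime cong_sym coprime_1_left)
  then show ?thesis using q_gt_1 by (simp add: coprime_power_left_iff)
qed

lemma coprime_r_minus_1: "coprime (r - 1) (int p)"
proof -
  have "\<not> int p dvd r - 1" using r_neq_1 by (simp add: cong_iff_dvd_diff)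
  then show ?thesis
    using prime_p by (metis coprime_commute prime_imp_coprime prime_nat_int_transfer)
qed

text \<open>As \<open>q\<close> is prime, \<open>r\<close> has order exactly \<open>q\<close> modulo \<open>p\<close>, so \<open>r ^ (k - 1) = 1\<close> forces
  \<open>q\<close> to divide \<open>k - 1\<close>. The exponent is shifted by \<open>q\<close> so that natural subtraction does not truncate.\<close>

lemma r_pow_eq_r:
  assumes "[r ^ k = r] (mod int p)"
  shows "q dvd k + q - 1"
proof (rule ccontr)
  define e where "e = k + q - 1"
  assume "\<not> q dvd k + q - 1"
  then have "coprime e q" using prime_q by (metis coprime_commute e_def prime_imp_coprime)
  moreover have "e \<noteq> 0" using q_gt_1 by (simp add: e_def)
  ultimately obtain x y where xy: "e * x = q * y + 1"
    using coprime_bezout_strong[of e q] q_gt_1 by auto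
  have "[r ^ k * r ^ q = r * 1] (mod int p)" by (rule cong_mult[OF assms r_pow_q])
  moreover have "r ^ k * r ^ q = r * r ^ e"
    using q_gt_1 by (simp add: e_def flip: power_add power_Suc)
  ultimately have "[r ^ e = 1] (mod int p)"
    using coprime_r by (metis cong_mult_lcancel)
  then have "[r ^ (e * x) = 1] (mod int p)"
    using cong_pow[of "r ^ e" 1 _ x] by (simp add: power_mult)
  moreover have "[r ^ (e * x) = r ^ 1] (mod int p)"
    unfolding xy by (rule r_pow_cong) (simp only: cong_def add.commute[of _ 1] mod_mult_self2)
  ultimately show False using r_neq_1 by (metis cong_sym cong_trans power_one_right)
qed

text \<open>The triple \<open>(i, x, y)\<close> stands for \<open>a\<^sup>i b\<^sup>x c\<^sup>y\<close>; the factor \<open>r ^ j\<close> comes from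
  moving \<open>b\<^sup>x c\<^sup>y\<close> past \<open>a\<^sup>j\<close>.\<close>

definition M :: "(nat \<times> int \<times> int) monoid" where
  "M = \<lparr>carrier = {..<q ^ 2} \<times> {0..<int p} \<times> {0..<int p},
    monoid.mult = (\<lambda>(i, x, y) (j, x', y').
      ((i + j) mod q ^ 2, (r ^ j * x + x') mod int p, (r ^ j * y + y') mod int p)),
    one = (0, 0, 0)\<rparr>"

lemma in_carrier_M [simp]:
  "(i, x, y) \<in> carrier M \<longleftrightarrow> i < q ^ 2 \<and> 0 \<le> x \<and> x < int p \<and> 0 \<le> y \<and> y < int p"
  by (auto simp: M_def)

lemma mult_M [simp]:
  "(i, x, y) \<otimes>\<^bsub>M\<^esub> (j, x', y') =
    ((i + j) mod q ^ 2, (r ^ j * x + x') mod int p, (r ^ j * y + y') mod int p)"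
  by (simp add: M_def)

lemma one_M: "\<one>\<^bsub>M\<^esub> = (0, 0, 0)"
  by (simp add: M_def)

lemma p_pos [simp]: "int p > 0" "p > 0" and q_pos [simp]: "q > 0"
  using p_gt_1 q_gt_1 by auto

lemma r_pow_reduce: "(r ^ (n mod q ^ 2) * x + y) mod int p = (r ^ n * x + y) mod int p"
  using cong_add[OF cong_mult[OF r_pow_mod_q2 cong_refl] cong_refl] by (simp add: cong_def)

lemma group_M: "group M"
proof (rule groupI)
  fix X assume X: "X \<in> carrier M"
  obtain i x y where [simp]: "X = (i, x, y)" by (cases X)
  have i: "i < q ^ 2" using X by simp
  define s where "s = r ^ (q ^ 2 - i)"
  have rs: "[r ^ i * s = 1] (mod int p)"
    using i r_pow_cong[of "q ^ 2" 0] by (simp add: s_def cong_def flip: power_add)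
  have "(r ^ i * ((- (s * z)) mod int p) + z) mod int p = 0" for z
  proof -
    have "[r ^ i * ((- (s * z)) mod int p) + z = r ^ i * (- (s * z)) + z] (mod int p)"
      by (intro cong_add cong_mult cong_refl) (simp add: cong_def)
    also have "r ^ i * (- (s * z)) + z = (1 - r ^ i * s) * z" by (simp add: algebra_simps)
    also have "[\<dots> = (1 - 1) * z] (mod int p)"
      by (intro cong_mult cong_diff cong_refl rs)
    finally show ?thesis by (simp add: cong_def)
  qed
  then have "((q ^ 2 - i) mod q ^ 2, (- (s * x)) mod int p, (- (s * y)) mod int p) \<otimes>\<^bsub>M\<^esub> X = \<one>\<^bsub>M\<^esub>"
    using i by (simp add: one_M mod_simps)
  then show "\<exists>Y\<in>carrier M. Y \<otimes>\<^bsub>M\<^esub> X = \<one>\<^bsub>M\<^esub>"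
    by (rule bexI) simp
next
  fix X Y Z assume "X \<in> carrier M" "Y \<in> carrier M" "Z \<in> carrier M"
  obtain i x x' j y y' k z z' where [simp]: "X = (i, x, x')" "Y = (j, y, y')" "Z = (k, z, z')"
    by (metis prod_cases3)
  have "(r ^ k * ((r ^ j * u + v) mod int p) + w) mod int p =
        (r ^ ((j + k) mod q ^ 2) * u + (r ^ k * v + w) mod int p) mod int p" for u v w
  proof -
    have "(r ^ k * ((r ^ j * u + v) mod int p) + w) mod int p = (r ^ k * (r ^ j * u + v) + w) mod int p"
      by (metis mod_add_left_eq mod_mult_right_eq)
    also have "\<dots> = (r ^ (j + k) * u + (r ^ k * v + w)) mod int p"
      by (simp add: algebra_simps power_add)
    finally show ?thesis by (simp add: r_pow_reduce mod_simps)
  qed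
  then show "X \<otimes>\<^bsub>M\<^esub> Y \<otimes>\<^bsub>M\<^esub> Z = X \<otimes>\<^bsub>M\<^esub> (Y \<otimes>\<^bsub>M\<^esub> Z)"
    by (simp add: mod_simps add.assoc)
qed (auto simp: one_M)

sublocale M: group M by (rule group_M)

lemma pow_M_A: "(i, 0, 0) [^]\<^bsub>M\<^esub> (n :: nat) = (n * i mod q ^ 2, 0, 0)"
  by (induction n) (auto simp: one_M M.nat_pow_Suc mod_simps algebra_simps)

lemma pow_M_N: "(0, x, y) [^]\<^bsub>M\<^esub> (n :: nat) = (0, int n * x mod int p, int n * y mod int p)"
  by (induction n) (auto simp: one_M M.nat_pow_Suc mod_simps algebra_simps)

lemma int_pow_M_N:
  assumes "0 \<le> x" "x < int p" "0 \<le> y" "y < int p"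
  shows "(0, x, y) [^]\<^bsub>M\<^esub> (n :: int) = (0, n * x mod int p, n * y mod int p)"
proof -
  have c: "(0, x, y) \<in> carrier M" using assms by simp
  have "(0, x, y) [^]\<^bsub>M\<^esub> p = \<one>\<^bsub>M\<^esub>" by (simp add: pow_M_N one_M)
  then have "(0, x, y) [^]\<^bsub>M\<^esub> n = (0, x, y) [^]\<^bsub>M\<^esub> int (nat (n mod int p))"
    using M.int_pow_mod[OF c, of p n] by simp
  also have "\<dots> = (0, x, y) [^]\<^bsub>M\<^esub> nat (n mod int p)" by (rule int_pow_int)
  finally show ?thesis by (simp add: pow_M_N mod_simps)
qed

lemma fst_pow_M: "fst (X [^]\<^bsub>M\<^esub> (n :: nat)) = n * fst X mod q ^ 2"
proof (induction n)
  case (Suc n)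
  obtain i x y j u v where "X = (i, x, y)" "X [^]\<^bsub>M\<^esub> n = (j, u, v)" by (metis prod_cases3)
  then show ?case using Suc by (simp add: M.nat_pow_Suc mod_simps algebra_simps)
qed (simp add: one_M)

lemma M_decompose:
  assumes "(i, x, y) \<in> carrier M"
  shows "(i, x, y) = (1, 0, 0) [^]\<^bsub>M\<^esub> i \<otimes>\<^bsub>M\<^esub> ((0, 1, 0) [^]\<^bsub>M\<^esub> x \<otimes>\<^bsub>M\<^esub> (0, 0, 1) [^]\<^bsub>M\<^esub> y)"
  using assms p_gt_1 by (simp add: pow_M_A int_pow_M_N)

section \<open>The presented group is the model\<close>

abbreviation "GG \<equiv> G_group p q r"

lemma presentation_G: "presentation (G_relations p q r)"
proof
  interpret F: group "free_group :: gen word set monoid" by (rule group_free_group)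
  have "free_gen x \<in> carrier free_group" for x :: gen
    by (simp add: free_gen_def)
  then show "G_relations p q r \<subseteq> carrier free_group \<times> carrier free_group"
    by (auto simp: G_relations_def Let_def commutator_def)
qed

end

text \<open>Conjugation by \<open>a\<close> is a homomorphism, so its effect on \<open>d\<close> determines it on powers.\<close>

lemma (in group) int_pow_conjugate:
  fixes r z :: int
  assumes car: "a \<in> carrier G" "d \<in> carrier G" and da: "inv a \<otimes> d \<otimes> a = d [^] r"
  shows "d [^] z \<otimes> a = a \<otimes> d [^] (r * z)"
proof -
  have cancel: "a \<otimes> (inv a \<otimes> g) = g" if "g \<in> carrier G" for g
    using car that by (simp flip: m_assoc)
  have conj: "(\<lambda>g. inv a \<otimes> g \<otimes> a) \<in> hom G G"
    using car by (intro homI) (simp_all add: m_assoc cancel)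
  have "inv a \<otimes> d [^] z \<otimes> a = (inv a \<otimes> d \<otimes> a) [^] z"
    using hom_int_pow[OF conj car(2) group_axioms group_axioms] .
  also have "\<dots> = d [^] (r * z)" by (simp add: da car int_pow_pow)
  finally show ?thesis using car cancel[of "d [^] z \<otimes> a"] by (simp add: m_assoc)
qed

text \<open>The relations say that \<open>b\<close> and \<open>c\<close> commute and that moving a power of either past \<open>a\<close> multiplies
  the exponent by \<open>r\<close>. So products of normal forms are normal forms, computed as in the model.\<close>

lemma (in group) normal_form_mult:
  fixes r :: int
  assumes car: "a \<in> carrier G" "b \<in> carrier G" "c \<in> carrier G"
    and bc: "inv b \<otimes> inv c \<otimes> b \<otimes> c = \<one>"
    and ba: "inv a \<otimes> b \<otimes> a = b [^] r" and ca: "inv a \<otimes> c \<otimes> a = c [^] r"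
  shows "a [^] (i :: nat) \<otimes> (b [^] (x :: int) \<otimes> c [^] (y :: int)) \<otimes>
      (a [^] (j :: nat) \<otimes> (b [^] (x' :: int) \<otimes> c [^] (y' :: int))) =
    a [^] (i + j) \<otimes> (b [^] (r ^ j * x + x') \<otimes> c [^] (r ^ j * y + y'))"
proof -
  have move: "d [^] z \<otimes> a [^] n = a [^] n \<otimes> d [^] (r ^ n * z)"
    if d: "d \<in> carrier G" and da: "inv a \<otimes> d \<otimes> a = d [^] r" for d n and z :: int
  proof -
    show ?thesis
    proof (induction n arbitrary: z)
      case (Suc n)
      have "d [^] z \<otimes> a [^] Suc n = d [^] z \<otimes> a [^] n \<otimes> a"
        using car d by (simp add: m_assoc)
      also have "\<dots> = a [^] n \<otimes> (d [^] (r ^ n * z) \<otimes> a)"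
        using car d by (simp add: Suc m_assoc)
      also have "\<dots> = a [^] Suc n \<otimes> d [^] (r ^ Suc n * z)"
        using car d by (simp add: int_pow_conjugate[OF car(1) d da] m_assoc mult.assoc)
      finally show ?case .
    qed (use car d in simp)
  qed
  have "inv c \<otimes> (b \<otimes> c) = b"
    using bc car by (simp add: m_assoc inv_solve_left')
  then have "inv c \<otimes> b \<otimes> c = b [^] (1 :: int)" using car by (simp add: m_assoc)
  then have "b [^] x' \<otimes> c = c \<otimes> b [^] x'" using int_pow_conjugate[of c b 1 x'] car by simp
  then have "inv (b [^] x') \<otimes> c \<otimes> b [^] x' = c [^] (1 :: int)"
    using car by (simp add: m_assoc inv_solve_left')
  then have cb: "c [^] z \<otimes> b [^] x' = b [^] x' \<otimes> c [^] z" for z :: int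
    using int_pow_conjugate[of "b [^] x'" c 1 z] car by simp
  have "a [^] i \<otimes> (b [^] x \<otimes> c [^] y) \<otimes> (a [^] j \<otimes> (b [^] x' \<otimes> c [^] y')) =
      a [^] i \<otimes> (b [^] x \<otimes> (c [^] y \<otimes> a [^] j) \<otimes> (b [^] x' \<otimes> c [^] y'))"
    using car by (simp add: m_assoc)
  also have "\<dots> = a [^] i \<otimes> (b [^] x \<otimes> a [^] j \<otimes> (c [^] (r ^ j * y) \<otimes> b [^] x' \<otimes> c [^] y'))"
    using car by (simp add: move[OF car(3) ca] m_assoc)
  also have "\<dots> = a [^] i \<otimes> (a [^] j \<otimes> b [^] (r ^ j * x) \<otimes> (b [^] x' \<otimes> c [^] (r ^ j * y) \<otimes> c [^] y'))"
    by (simp only: move[OF car(2) ba] cb)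
  also have "\<dots> = a [^] i \<otimes> a [^] j \<otimes> ((b [^] (r ^ j * x) \<otimes> b [^] x') \<otimes> (c [^] (r ^ j * y) \<otimes> c [^] y'))"
    using car by (simp add: m_assoc)
  finally show ?thesis using car by (simp add: nat_pow_mult int_pow_mult)
qed

context scalar_action
begin

definition model_gen :: "gen \<Rightarrow> nat \<times> int \<times> int" where
  "model_gen x = (case x of GenA \<Rightarrow> (1, 0, 0) | GenB \<Rightarrow> (0, 1, 0) | GenC \<Rightarrow> (0, 0, 1))"

lemma model_gen_simps [simp]:
  "model_gen GenA = (1, 0, 0)" "model_gen GenB = (0, 1, 0)" "model_gen GenC = (0, 0, 1)"
  by (simp_all add: model_gen_def)

lemma q2_gt_1: "q ^ 2 > 1"
  using q2_gt q_gt_1 by linarith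

lemma range_model_gen: "range model_gen \<subseteq> carrier M"
  using p_gt_1 q2_gt_1 by (auto simp: model_gen_def split: gen.split)

lemma model_satisfies_relations:
  assumes "(u, v) \<in> G_relations p q r"
  shows "free_lift M model_gen u = free_lift M model_gen v"
proof -
  interpret F: group "free_group :: gen word set monoid" by (rule group_free_group)
  let ?l = "free_lift M model_gen"
  interpret l: group_hom free_group M ?l
    by unfold_locales (rule M.free_lift_hom[OF range_model_gen])
  have g: "free_gen x \<in> carrier free_group" for x :: gen
    by (simp add: free_gen_def)
  have lg: "?l (free_gen x) = model_gen x" for x
    by (rule M.free_lift_gen[OF range_model_gen])
  have car: "(1, 0, 0) \<in> carrier M" "(0, 1, 0) \<in> carrier M" "(0, 0, 1) \<in> carrier M"
    using p_gt_1 q2_gt_1 by auto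
  have "inv\<^bsub>M\<^esub> (0, 1, 0) \<otimes>\<^bsub>M\<^esub> (inv\<^bsub>M\<^esub> (0, 0, 1) \<otimes>\<^bsub>M\<^esub> ((0, 1, 0) \<otimes>\<^bsub>M\<^esub> (0, 0, 1))) = \<one>\<^bsub>M\<^esub>"
    using car by (simp only: M.inv_solve_left' M.m_closed M.inv_closed M.one_closed M.r_one) simp
  then have comm: "commutator M (0, 1, 0) (0, 0, 1) = \<one>\<^bsub>M\<^esub>"
    using car by (simp only: commutator_def M.m_assoc M.m_closed M.inv_closed)
  have "inv\<^bsub>M\<^esub> (1, 0, 0) \<otimes>\<^bsub>M\<^esub> ((0, 1, 0) \<otimes>\<^bsub>M\<^esub> (1, 0, 0)) = (0, 1, 0) [^]\<^bsub>M\<^esub> r"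
    using car by (simp only: M.inv_solve_left' M.m_closed M.int_pow_closed)
      (use p_gt_1 in \<open>simp add: int_pow_M_N\<close>)
  then have b: "inv\<^bsub>M\<^esub> (1, 0, 0) \<otimes>\<^bsub>M\<^esub> (0, 1, 0) \<otimes>\<^bsub>M\<^esub> (1, 0, 0) = (0, 1, 0) [^]\<^bsub>M\<^esub> r"
    using car by (simp only: M.m_assoc M.inv_closed)
  have "inv\<^bsub>M\<^esub> (1, 0, 0) \<otimes>\<^bsub>M\<^esub> ((0, 0, 1) \<otimes>\<^bsub>M\<^esub> (1, 0, 0)) = (0, 0, 1) [^]\<^bsub>M\<^esub> r"
    using car by (simp only: M.inv_solve_left' M.m_closed M.int_pow_closed)
      (use p_gt_1 in \<open>simp add: int_pow_M_N\<close>)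
  then have c: "inv\<^bsub>M\<^esub> (1, 0, 0) \<otimes>\<^bsub>M\<^esub> (0, 0, 1) \<otimes>\<^bsub>M\<^esub> (1, 0, 0) = (0, 0, 1) [^]\<^bsub>M\<^esub> r"
    using car by (simp only: M.m_assoc M.inv_closed)
  have l: "?l (commutator free_group x y) = commutator M (?l x) (?l y)"
    if "x \<in> carrier free_group" "y \<in> carrier free_group" for x y
    using that by (simp add: commutator_def)
  have orders: "(1, 0, 0) [^]\<^bsub>M\<^esub> (q ^ 2) = \<one>\<^bsub>M\<^esub>" "(0, 1, 0) [^]\<^bsub>M\<^esub> p = \<one>\<^bsub>M\<^esub>"
    "(0, 0, 1) [^]\<^bsub>M\<^esub> p = \<one>\<^bsub>M\<^esub>"
    by (simp_all add: pow_M_A pow_M_N one_M)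
  show ?thesis
    using assms comm b c orders unfolding G_relations_def Let_def
    by (auto simp: l lg g l.hom_nat_pow l.hom_int_pow simp del: mult_M)
qed

text \<open>By the multiplication rule, \<open>(i, x, y) \<mapsto> a\<^sup>i b\<^sup>x c\<^sup>y\<close> is a homomorphism from the model,
  and it hits the generators. It is injective because the map in the other direction, given on
  generators, recovers \<open>(i, x, y)\<close> from a word for \<open>a\<^sup>i b\<^sup>x c\<^sup>y\<close>. That the second map takes equal
  values on words of the same class is von Dyck's theorem.\<close>

lemma G_group_iso_model: "GG \<cong> M"
proof -
  interpret R: presentation "G_relations p q r" by (rule presentation_G)
  let ?\<pi> = "presented_class (G_relations p q r)"
  have GG: "presented_group (G_relations p q r) = GG" by (simp add: G_group_def)
  interpret G: group GG by (rule group_G_group)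
  interpret pi: group_hom free_group GG ?\<pi> using R.pi.group_hom_axioms by (simp add: GG)
  interpret l: group_hom free_group M "free_lift M model_gen"
    by unfold_locales (rule M.free_lift_hom[OF range_model_gen])
  define fa fb fc where "fa = free_gen GenA" and "fb = free_gen GenB" and "fc = free_gen GenC"
  define a b c where "a = ?\<pi> fa" and "b = ?\<pi> fb" and "c = ?\<pi> fc"
  have f [simp]: "fa \<in> carrier free_group" "fb \<in> carrier free_group" "fc \<in> carrier free_group"
    by (simp_all add: fa_def fb_def fc_def free_gen_def)
  have car [simp]: "a \<in> carrier GG" "b \<in> carrier GG" "c \<in> carrier GG"
    by (simp_all add: a_def b_def c_def)
  have rel: "(fa [^]\<^bsub>free_group\<^esub> (q ^ 2), \<one>\<^bsub>free_group\<^esub>) \<in> G_relations p q r"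
    "(fb [^]\<^bsub>free_group\<^esub> p, \<one>\<^bsub>free_group\<^esub>) \<in> G_relations p q r"
    "(fc [^]\<^bsub>free_group\<^esub> p, \<one>\<^bsub>free_group\<^esub>) \<in> G_relations p q r"
    "(commutator free_group fb fc, \<one>\<^bsub>free_group\<^esub>) \<in> G_relations p q r"
    "(inv\<^bsub>free_group\<^esub> fa \<otimes>\<^bsub>free_group\<^esub> fb \<otimes>\<^bsub>free_group\<^esub> fa, fb [^]\<^bsub>free_group\<^esub> r) \<in> G_relations p q r"
    "(inv\<^bsub>free_group\<^esub> fa \<otimes>\<^bsub>free_group\<^esub> fc \<otimes>\<^bsub>free_group\<^esub> fa, fc [^]\<^bsub>free_group\<^esub> r) \<in> G_relations p q r"
    by (simp_all add: G_relations_def Let_def fa_def fb_def fc_def)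
  note relG = rel[THEN R.presented_class_relation]
  have a: "a [^]\<^bsub>GG\<^esub> (q ^ 2) = \<one>\<^bsub>GG\<^esub>" and b: "b [^]\<^bsub>GG\<^esub> p = \<one>\<^bsub>GG\<^esub>" and c: "c [^]\<^bsub>GG\<^esub> p = \<one>\<^bsub>GG\<^esub>"
    using relG(1-3) by (simp_all add: a_def b_def c_def pi.hom_nat_pow GG)
  have bc: "inv\<^bsub>GG\<^esub> b \<otimes>\<^bsub>GG\<^esub> inv\<^bsub>GG\<^esub> c \<otimes>\<^bsub>GG\<^esub> b \<otimes>\<^bsub>GG\<^esub> c = \<one>\<^bsub>GG\<^esub>"
    using relG(4) by (simp add: b_def c_def commutator_def GG)
  have ba: "inv\<^bsub>GG\<^esub> a \<otimes>\<^bsub>GG\<^esub> b \<otimes>\<^bsub>GG\<^esub> a = b [^]\<^bsub>GG\<^esub> r"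
    and ca: "inv\<^bsub>GG\<^esub> a \<otimes>\<^bsub>GG\<^esub> c \<otimes>\<^bsub>GG\<^esub> a = c [^]\<^bsub>GG\<^esub> r"
    using relG(5,6) by (simp_all add: a_def b_def c_def pi.hom_int_pow GG)
  define W :: "nat \<times> int \<times> int \<Rightarrow> gen word set" where
    "W = (\<lambda>(i, x, y). fa [^]\<^bsub>free_group\<^esub> i \<otimes>\<^bsub>free_group\<^esub>
      (fb [^]\<^bsub>free_group\<^esub> x \<otimes>\<^bsub>free_group\<^esub> fc [^]\<^bsub>free_group\<^esub> y))"
  have W: "W X \<in> carrier free_group" for X by (simp add: W_def split: prod.split)
  define \<Psi> where "\<Psi> X = ?\<pi> (W X)" for X
  have \<Psi>: "\<Psi> (i, x, y) = a [^]\<^bsub>GG\<^esub> i \<otimes>\<^bsub>GG\<^esub> (b [^]\<^bsub>GG\<^esub> x \<otimes>\<^bsub>GG\<^esub> c [^]\<^bsub>GG\<^esub> y)" for i x y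
    by (simp add: \<Psi>_def W_def a_def b_def c_def pi.hom_nat_pow pi.hom_int_pow GG)
  have lW: "free_lift M model_gen (W X) = X" if "X \<in> carrier M" for X
  proof -
    obtain i x y where X: "X = (i, x, y)" by (cases X)
    have "free_lift M model_gen (W X) = (1, 0, 0) [^]\<^bsub>M\<^esub> i \<otimes>\<^bsub>M\<^esub>
        ((0, 1, 0) [^]\<^bsub>M\<^esub> x \<otimes>\<^bsub>M\<^esub> (0, 0, 1) [^]\<^bsub>M\<^esub> y)"
      by (simp add: X W_def l.hom_nat_pow l.hom_int_pow del: mult_M)
        (simp add: fa_def fb_def fc_def M.free_lift_gen[OF range_model_gen] del: mult_M)
    also have "\<dots> = X" using that unfolding X by (rule M_decompose[symmetric])
    finally show ?thesis .
  qed
  have hom: "\<Psi> \<in> hom M GG"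
  proof (rule homI)
    fix X Y assume "X \<in> carrier M" "Y \<in> carrier M"
    obtain i x y j x' y' where X: "X = (i, x, y)" "Y = (j, x', y')" by (metis prod_cases3)
    show "\<Psi> (X \<otimes>\<^bsub>M\<^esub> Y) = \<Psi> X \<otimes>\<^bsub>GG\<^esub> \<Psi> Y"
      unfolding X by (simp add: \<Psi> G.normal_form_mult[OF car bc ba ca]
          G.nat_pow_mod[OF car(1) a] G.int_pow_mod[OF car(2) b] G.int_pow_mod[OF car(3) c])
  qed (simp add: \<Psi>_def W)
  then interpret Psi: group_hom M GG \<Psi> by unfold_locales
  have inj: "inj_on \<Psi> (carrier M)"
  proof (rule inj_onI)
    fix X Y assume XY: "X \<in> carrier M" "Y \<in> carrier M" "\<Psi> X = \<Psi> Y"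
    have "free_lift M model_gen (W X) = free_lift M model_gen (W Y)"
      by (rule R.free_lift_eq_if_presented_class_eq[OF group_M range_model_gen
          model_satisfies_relations W W XY(3)[unfolded \<Psi>_def]])
    then show "X = Y" using XY by (simp add: lW)
  qed
  have "carrier GG = \<Psi> ` carrier M"
  proof (unfold G_group_def, rule R.presented_group_generated, unfold GG)
    show "subgroup (\<Psi> ` carrier M) GG" by (rule Psi.img_is_subgroup)
    have gens: "\<Psi> (1, 0, 0) = a" "\<Psi> (0, 1, 0) = b" "\<Psi> (0, 0, 1) = c"
      by (simp_all add: \<Psi>)
    have "(1, 0, 0) \<in> carrier M" "(0, 1, 0) \<in> carrier M" "(0, 0, 1) \<in> carrier M"
      using p_gt_1 q2_gt_1 by auto
    then have "a \<in> \<Psi> ` carrier M" "b \<in> \<Psi> ` carrier M" "c \<in> \<Psi> ` carrier M"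
      unfolding gens[symmetric] by (intro imageI; simp only:)+
    then show "?\<pi> (free_gen x) \<in> \<Psi> ` carrier M" for x
      by (cases x) (simp_all add: a_def b_def c_def fa_def fb_def fc_def)
  qed
  then have "\<Psi> \<in> iso M GG"
    using hom inj by (auto simp: iso_def bij_betw_def)
  then show ?thesis by (rule M.iso_sym[OF is_isoI])
qed

end

section \<open>Matrices acting on the elementary abelian factor\<close>

context scalar_action
begin

abbreviation "V \<equiv> integer_mod_group p \<times>\<times> integer_mod_group p"
abbreviation "Mat \<equiv> matrix_monoid 2 (residue_ring (int p))"

lemma in_carrier_mod_group [simp]:
  "x \<in> carrier (integer_mod_group p) \<longleftrightarrow> 0 \<le> x \<and> x < int p"
  "x \<in> carrier (integer_mod_group q) \<longleftrightarrow> 0 \<le> x \<and> x < int q"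
  unfolding carrier_integer_mod_group using p_gt_1 q_gt_1 by auto

lemma group_V: "group V"
  by (intro DirProd_group) simp_all

lemma residue_ring_ring: "ring (residue_ring (int p))"
proof -
  interpret residues "int p" "residue_ring (int p)"
    using p_gt_1 by unfold_locales simp_all
  show ?thesis by (rule cring.axioms(1)[OF cring])
qed

lemma residue_ring_sel:
  "carrier (residue_ring (int p)) = {0..<int p}"
  "x \<oplus>\<^bsub>residue_ring (int p)\<^esub> y = (x + y) mod int p"
  "x \<otimes>\<^bsub>residue_ring (int p)\<^esub> y = (x * y) mod int p"
  "\<one>\<^bsub>residue_ring (int p)\<^esub> = 1" "\<zero>\<^bsub>residue_ring (int p)\<^esub> = 0"
  by (auto simp: residue_ring_def)

lemma monoid_Mat: "monoid Mat"
  by (rule ring.monoid_matrix_monoid[OF residue_ring_ring])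

lemma lessThan_2: "{..<2 :: nat} = {0, 1}"
  by auto

lemma Mat_entry:
  assumes "A \<in> carrier Mat" "i < 2" "j < 2"
  shows "0 \<le> A (i, j)" "A (i, j) < int p"
  using assms by (auto simp: matrix_monoid_def residue_ring_sel PiE_iff)

lemma mult_Mat:
  assumes "A \<in> carrier Mat" "B \<in> carrier Mat" "i < 2" "j < 2"
  shows "(A \<otimes>\<^bsub>Mat\<^esub> B) (i, j) = (A (i, 0) * B (0, j) + A (i, 1) * B (1, j)) mod int p"
proof -
  interpret ring "residue_ring (int p)" by (rule residue_ring_ring)
  let ?R = "residue_ring (int p)"
  have "(A \<otimes>\<^bsub>Mat\<^esub> B) (i, j) = (\<Oplus>\<^bsub>?R\<^esub>k\<in>{..<2}. A (i, k) \<otimes>\<^bsub>?R\<^esub> B (k, j))"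
    using assms by (simp add: matrix_monoid_def)
  also have "\<dots> = (\<Oplus>\<^bsub>?R\<^esub>k\<in>{0, 1}. A (i, k) \<otimes>\<^bsub>?R\<^esub> B (k, j))"
    by (simp only: lessThan_2)
  also have "\<dots> = A (i, 0) \<otimes>\<^bsub>?R\<^esub> B (0, j) \<oplus>\<^bsub>?R\<^esub> (A (i, 1) \<otimes>\<^bsub>?R\<^esub> B (1, j))"
    using Mat_entry[OF assms(1)] Mat_entry[OF assms(2)] assms(3,4)
    by (subst finsum_insert) (auto simp: residue_ring_sel)
  finally show ?thesis by (simp add: residue_ring_sel mod_simps)
qed

lemma one_Mat: "i < 2 \<Longrightarrow> j < 2 \<Longrightarrow> \<one>\<^bsub>Mat\<^esub> (i, j) = (if i = j then 1 else 0)"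
  by (simp add: matrix_monoid_def residue_ring_sel)

lemma Mat_eqI:
  assumes "A \<in> carrier Mat" "B \<in> carrier Mat"
    and "A (0, 0) = B (0, 0)" "A (0, 1) = B (0, 1)" "A (1, 0) = B (1, 0)" "A (1, 1) = B (1, 1)"
  shows "A = B"
proof (rule extensionalityI)
  show "A \<in> extensional ({0, 1} \<times> {0, 1})" "B \<in> extensional ({0, 1} \<times> {0, 1})"
    using assms(1,2) by (auto simp: matrix_monoid_def lessThan_2 PiE_iff)
qed (use assms in auto)

definition mat2 :: "int \<Rightarrow> int \<Rightarrow> int \<Rightarrow> int \<Rightarrow> nat \<times> nat \<Rightarrow> int" where
  "mat2 a b c d = (\<lambda>(i, j)\<in>{..<2} \<times> {..<2}.
     if i = 0 then if j = 0 then a else b else if j = 0 then c else d)"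

lemma mat2_in_Mat:
  assumes "(a, c) \<in> carrier V" "(b, d) \<in> carrier V"
  shows "mat2 a b c d \<in> carrier Mat"
  using assms unfolding mat2_def by (auto simp: matrix_monoid_def residue_ring_sel PiE_iff)

lemma mat2_entry [simp]:
  "mat2 a b c d (0, 0) = a" "mat2 a b c d (0, Suc 0) = b"
  "mat2 a b c d (Suc 0, 0) = c" "mat2 a b c d (Suc 0, Suc 0) = d"
  by (simp_all add: mat2_def)

definition act :: "(nat \<times> nat \<Rightarrow> int) \<Rightarrow> int \<times> int \<Rightarrow> int \<times> int" where
  "act A = (\<lambda>(x, y). ((A (0, 0) * x + A (0, 1) * y) mod int p, (A (1, 0) * x + A (1, 1) * y) mod int p))"

lemma act_closed: "act A v \<in> carrier V"
  by (cases v) (simp add: act_def)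

lemma act_one: "v \<in> carrier V \<Longrightarrow> act \<one>\<^bsub>Mat\<^esub> v = v"
  by (cases v) (simp add: act_def one_Mat)

lemma act_hom: "act A (v \<otimes>\<^bsub>V\<^esub> w) = act A v \<otimes>\<^bsub>V\<^esub> act A w"
proof -
  have "(a * ((x + x') mod int p) + b * ((y + y') mod int p)) mod int p =
    ((a * x + b * y) mod int p + (a * x' + b * y') mod int p) mod int p" for a b x x' y y'
  proof -
    have "[a * ((x + x') mod int p) + b * ((y + y') mod int p) = a * (x + x') + b * (y + y')] (mod int p)"
      by (intro cong_add cong_mult cong_refl) (simp_all add: cong_def)
    also have "a * (x + x') + b * (y + y') = (a * x + b * y) + (a * x' + b * y')"
      by (simp add: algebra_simps)
    finally show ?thesis by (simp only: cong_def mod_add_eq)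
  qed
  then show ?thesis by (cases v; cases w) (simp add: act_def)
qed

lemma act_mult:
  assumes "A \<in> carrier Mat" "B \<in> carrier Mat"
  shows "act (A \<otimes>\<^bsub>Mat\<^esub> B) v = act A (act B v)"
proof -
  have "((a * c + b * d) mod int p * x + (a * e + b * f) mod int p * y) mod int p =
    (a * ((c * x + e * y) mod int p) + b * ((d * x + f * y) mod int p)) mod int p"
    for a b c d e f x y
  proof -
    have "[(a * c + b * d) mod int p * x + (a * e + b * f) mod int p * y =
      (a * c + b * d) * x + (a * e + b * f) * y] (mod int p)"
      by (intro cong_add cong_mult cong_refl) (simp_all add: cong_def)
    also have "(a * c + b * d) * x + (a * e + b * f) * y =
      a * (c * x + e * y) + b * (d * x + f * y)"
      by (simp add: algebra_simps)
    also have "[\<dots> = a * ((c * x + e * y) mod int p) + b * ((d * x + f * y) mod int p)] (mod int p)"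
      by (intro cong_add cong_mult cong_refl) (simp_all add: cong_def)
    finally show ?thesis by (simp add: cong_def)
  qed
  then show ?thesis by (cases v) (simp add: act_def mult_Mat[OF assms])
qed

abbreviation "GLp \<equiv> GL 2 (residue_ring (int p))"
abbreviation "Zq \<equiv> integer_mod_group q"

lemma GL_sel:
  "carrier GLp = Units Mat" "A \<otimes>\<^bsub>GLp\<^esub> B = A \<otimes>\<^bsub>Mat\<^esub> B" "\<one>\<^bsub>GLp\<^esub> = \<one>\<^bsub>Mat\<^esub>"
  by (simp_all add: GL_def units_of_carrier units_of_mult units_of_one)

lemma GL_in_Mat: "A \<in> Units Mat \<Longrightarrow> A \<in> carrier Mat"
  by (simp add: Units_def)

lemma group_GL_Zq: "group (GLp \<times>\<times> Zq)"
  by (intro DirProd_group ring.group_GL[OF residue_ring_ring]) simp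

definition GL_action :: "(nat \<times> nat \<Rightarrow> int) \<times> int \<Rightarrow> int \<times> int \<Rightarrow> int \<times> int" where
  "GL_action = (\<lambda>(A, j). restrict (act A) (carrier V))"

lemma GL_action_hom: "GL_action \<in> hom (GLp \<times>\<times> Zq) (AutoGroup V)"
proof (rule hom_into_AutoGroupI[OF group_GL_Zq])
  fix h assume "h \<in> carrier (GLp \<times>\<times> Zq)"
  show "GL_action h \<in> hom V V"
    using act_closed act_hom monoid.m_closed[OF group.is_monoid[OF group_V]]
    by (cases h, intro homI) (simp_all add: GL_action_def del: carrier_DirProd)
  show "GL_action h \<in> extensional (carrier V)"
    by (cases h) (simp add: GL_action_def)
next
  fix h h' x
  assume "h \<in> carrier (GLp \<times>\<times> Zq)" "h' \<in> carrier (GLp \<times>\<times> Zq)" "x \<in> carrier V"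
  then show "GL_action (h \<otimes>\<^bsub>GLp \<times>\<times> Zq\<^esub> h') x = GL_action h (GL_action h' x)"
    using act_closed by (cases h; cases h') (simp add: GL_action_def GL_sel act_mult GL_in_Mat)
next
  fix x assume "x \<in> carrier V"
  then show "GL_action \<one>\<^bsub>GLp \<times>\<times> Zq\<^esub> x = x"
    by (simp add: GL_action_def GL_sel act_one)
qed

section \<open>Automorphisms of the model\<close>

text \<open>The endomorphism with \<open>w \<mapsto> A w\<close> on the normal factor and \<open>a \<mapsto> a ^ (1 + q j) \<cdot> (r - 1) m\<close>, where
  \<open>m = (u, v)\<close>. Because \<open>r - 1\<close> is a unit modulo \<open>p\<close>, every vector has the form \<open>(r - 1) m\<close>; with
  this choice the geometric sums that arise in powers of the image of \<open>a\<close> become \<open>r ^ i - 1\<close>. The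
  matrix is arbitrary here, so that invertibility can be read off from the composition law.\<close>

definition Phi :: "(int \<times> int) \<times> (nat \<times> nat \<Rightarrow> int) \<times> int \<Rightarrow> nat \<times> int \<times> int \<Rightarrow> nat \<times> int \<times> int"
  where "Phi = (\<lambda>((u, v), A, j). \<lambda>X\<in>carrier M. case X of (i, x, y) \<Rightarrow>
    (i * (1 + q * nat j) mod q ^ 2,
     (A (0, 0) * x + A (0, 1) * y + (r ^ i - 1) * u) mod int p,
     (A (1, 0) * x + A (1, 1) * y + (r ^ i - 1) * v) mod int p))"

lemma Phi_apply:
  "(i, x, y) \<in> carrier M \<Longrightarrow> Phi ((u, v), A, j) (i, x, y) =
    (i * (1 + q * nat j) mod q ^ 2,
     (A (0, 0) * x + A (0, 1) * y + (r ^ i - 1) * u) mod int p,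
     (A (1, 0) * x + A (1, 1) * y + (r ^ i - 1) * v) mod int p)"
  by (simp add: Phi_def)

lemma Phi_closed: "X \<in> carrier M \<Longrightarrow> Phi ((u, v), A, j) X \<in> carrier M"
  by (cases X) (simp add: Phi_apply)

text \<open>Replacing \<open>a\<close> by \<open>a ^ (1 + q n)\<close> does not change the action on the normal factor, as \<open>a\<^sup>q\<close> is
  central.\<close>

lemma r_pow_1_plus: "[r ^ (i * (1 + q * n) mod q ^ 2) = r ^ i] (mod int p)"
proof -
  have "[i * (1 + q * n) = i] (mod q)"
    by (simp add: cong_def distrib_left mult.left_commute[of i q])
  then show ?thesis using r_pow_cong r_pow_mod_q2 cong_trans by blast
qed

text \<open>Either coordinate of the homomorphism property. The scalars \<open>s\<close> and \<open>s'\<close> stand for \<open>r ^ i\<close> and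
  \<open>r ^ i'\<close>; the term \<open>(s - 1) u\<close> is a coboundary, which is why it satisfies the cocycle identity
  \<open>s s' - 1 = s' (s - 1) + (s' - 1)\<close>.\<close>

lemma Phi_hom_coordinate:
  assumes "[S = s'] (mod m)" "[T = s * s'] (mod m)"
  shows "(a * ((s' * x + x') mod m) + b * ((s' * y + y') mod m) + (T - 1) * u) mod m =
    (S * ((a * x + b * y + (s - 1) * u) mod m) + (a * x' + b * y' + (s' - 1) * u) mod m) mod (m :: int)"
proof -
  have "[a * ((s' * x + x') mod m) + b * ((s' * y + y') mod m) + (T - 1) * u =
      a * (s' * x + x') + b * (s' * y + y') + (s * s' - 1) * u] (mod m)"
    by (intro cong_add cong_mult cong_diff cong_refl assms) (simp_all add: cong_def)
  also have "a * (s' * x + x') + b * (s' * y + y') + (s * s' - 1) * u =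
      s' * (a * x + b * y + (s - 1) * u) + (a * x' + b * y' + (s' - 1) * u)"
    by (simp add: algebra_simps)
  also have "[\<dots> = S * ((a * x + b * y + (s - 1) * u) mod m) + (a * x' + b * y' + (s' - 1) * u) mod m] (mod m)"
    by (intro cong_add cong_mult cong_sym[OF assms(1)]) (simp_all add: cong_def)
  finally show ?thesis by (simp add: cong_def)
qed

lemma Phi_hom: "Phi ((u, v), A, j) \<in> hom M M"
proof (rule homI)
  fix X Y assume XY: "X \<in> carrier M" "Y \<in> carrier M"
  obtain i x y i' x' y' where X: "X = (i, x, y)" "Y = (i', x', y')" by (metis prod_cases3)
  have c: "X \<otimes>\<^bsub>M\<^esub> Y \<in> carrier M" using XY by simp
  have T: "[r ^ ((i + i') mod q ^ 2) = r ^ i * r ^ i'] (mod int p)"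
    by (simp add: r_pow_mod_q2 flip: power_add)
  have "((i + i') mod q ^ 2) * (1 + q * nat j) mod q ^ 2 =
      (i * (1 + q * nat j) mod q ^ 2 + i' * (1 + q * nat j) mod q ^ 2) mod q ^ 2"
    by (metis add_mult_distrib mod_add_eq mod_mult_left_eq)
  then show "Phi ((u, v), A, j) (X \<otimes>\<^bsub>M\<^esub> Y) = Phi ((u, v), A, j) X \<otimes>\<^bsub>M\<^esub> Phi ((u, v), A, j) Y"
    using XY c unfolding X
    by (simp only: Phi_apply mult_M prod.inject Phi_hom_coordinate[OF r_pow_1_plus T] simp_thms)
qed (rule Phi_closed)

lemma Phi_mult_coordinate:
  assumes "[T = s] (mod m)"
  shows "(a * ((c * x + e * y + (s - 1) * u) mod m) + b * ((d * x + f * y + (s - 1) * v) mod m)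
      + (T - 1) * u') mod m =
    ((a * c + b * d) mod m * x + (a * e + b * f) mod m * y
      + (s - 1) * ((u' + (a * u + b * v) mod m) mod m)) mod (m :: int)"
proof -
  have "[a * ((c * x + e * y + (s - 1) * u) mod m) + b * ((d * x + f * y + (s - 1) * v) mod m)
      + (T - 1) * u' = a * (c * x + e * y + (s - 1) * u) + b * (d * x + f * y + (s - 1) * v)
      + (s - 1) * u'] (mod m)"
    by (intro cong_add cong_mult cong_diff cong_refl assms) (simp_all add: cong_def)
  also have "a * (c * x + e * y + (s - 1) * u) + b * (d * x + f * y + (s - 1) * v) + (s - 1) * u' =
      (a * c + b * d) * x + (a * e + b * f) * y + (s - 1) * (u' + (a * u + b * v))"
    by (simp add: algebra_simps)
  also have "[\<dots> = (a * c + b * d) mod m * x + (a * e + b * f) mod m * y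
      + (s - 1) * ((u' + (a * u + b * v) mod m) mod m)] (mod m)"
    by (intro cong_add cong_mult cong_diff cong_refl) (simp_all add: cong_def mod_add_right_eq)
  finally show ?thesis by (simp add: cong_def)
qed

text \<open>The parameters compose as in the semidirect product. The second factor of the complement is
  additive since \<open>(1 + q j) (1 + q j')\<close> is \<open>1 + q (j + j')\<close> modulo \<open>q\<^sup>2\<close>, and it acts trivially on
  \<open>m\<close> since \<open>r ^ (1 + q j)\<close> is \<open>r\<close> modulo \<open>p\<close>.\<close>

lemma Phi_mult:
  assumes A: "A \<in> carrier Mat" "A' \<in> carrier Mat" and j: "0 \<le> j" "0 \<le> j'" and X: "X \<in> carrier M"
  shows "Phi (m', A', j') (Phi (m, A, j) X) =
    Phi (m' \<otimes>\<^bsub>V\<^esub> act A' m, A' \<otimes>\<^bsub>Mat\<^esub> A, (j' + j) mod int q) X"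
proof -
  obtain i x y where X': "X = (i, x, y)" by (cases X)
  obtain u v u' v' where m: "m = (u, v)" "m' = (u', v')" by (cases m, cases m')
  have c: "Phi ((u, v), A, j) (i, x, y) \<in> carrier M" using X Phi_closed X' by blast
  have nat: "nat ((j' + j) mod int q) = (nat j' + nat j) mod q"
    using j by (simp add: nat_mod_distrib nat_add_distrib)
  have "i * (1 + q * nat j) mod q ^ 2 * (1 + q * nat j') mod q ^ 2 =
      i * ((1 + q * nat j) * (1 + q * nat j')) mod q ^ 2"
    by (simp only: mod_mult_left_eq mult.assoc)
  also have "(1 + q * nat j) * (1 + q * nat j') = q ^ 2 * (nat j * nat j') + (1 + q * (nat j' + nat j))"
    by (simp add: algebra_simps power2_eq_square)
  also have "i * \<dots> mod q ^ 2 = i * (1 + q * (nat j' + nat j)) mod q ^ 2"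
    by (simp only: distrib_left[of i "q ^ 2 * _"] mult.left_commute[of i "q ^ 2"] mod_mult_self4)
  also have "\<dots> = i * (1 + q * ((nat j' + nat j) mod q)) mod q ^ 2"
  proof -
    have "[q * (nat j' + nat j) = q * ((nat j' + nat j) mod q)] (mod q ^ 2)"
      by (simp only: cong_def power2_eq_square mult_mod_right mod_mod_trivial)
    then have "[i * (1 + q * (nat j' + nat j)) = i * (1 + q * ((nat j' + nat j) mod q))] (mod q ^ 2)"
      by (rule cong_mult[OF cong_refl cong_add[OF cong_refl]])
    then show ?thesis by (simp add: cong_def)
  qed
  finally have e: "i * (1 + q * nat j) mod q ^ 2 * (1 + q * nat j') mod q ^ 2 =
      i * (1 + q * ((nat j' + nat j) mod q)) mod q ^ 2" .
  have lt2: "(0 :: nat) < 2" "(1 :: nat) < 2" by simp_all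
  show ?thesis
    using X c unfolding X' m
    by (simp only: Phi_apply mult_DirProd act_def prod.case mult_integer_mod_group nat e prod.inject
        Phi_mult_coordinate[OF r_pow_1_plus] mult_Mat[OF A(2,1)] lt2 simp_thms)
qed

lemma Phi_one:
  assumes "X \<in> carrier M"
  shows "Phi (\<one>\<^bsub>V\<^esub>, \<one>\<^bsub>Mat\<^esub>, 0) X = X"
  using assms by (cases X) (simp add: Phi_apply one_Mat)

text \<open>The value at \<open>a\<close> gives \<open>j\<close>, and \<open>m\<close> after division by the unit \<open>r - 1\<close>; the values at \<open>b\<close> and
  \<open>c\<close> are the columns of the matrix.\<close>

lemma Phi_inject:
  assumes A: "A \<in> carrier Mat" "A' \<in> carrier Mat" and j: "j \<in> carrier Zq" "j' \<in> carrier Zq"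
    and m: "m \<in> carrier V" "m' \<in> carrier V"
    and eq: "\<And>X. X \<in> carrier M \<Longrightarrow> Phi (m, A, j) X = Phi (m', A', j') X"
  shows "m = m'" "A = A'" "j = j'"
proof -
  obtain u v u' v' where mm: "m = (u, v)" "m' = (u', v')" by (cases m, cases m')
  have car: "(1, 0, 0) \<in> carrier M" "(0, 1, 0) \<in> carrier M" "(0, 0, 1) \<in> carrier M"
    using p_gt_1 q2_gt_1 by auto
  note e = car[THEN eq[unfolded mm]]
  have lt: "1 + q * nat k < q ^ 2" if "k \<in> carrier Zq" for k
  proof -
    have "Suc (nat k) \<le> q" using that by auto
    then have "q * Suc (nat k) \<le> q * q" by (rule mult_le_mono2)
    then show ?thesis using q_gt_1 by (simp add: power2_eq_square)
  qed
  have a: "(1 + q * nat j) mod q ^ 2 = (1 + q * nat j') mod q ^ 2"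
      "[(r - 1) * u = (r - 1) * u'] (mod int p)" "[(r - 1) * v = (r - 1) * v'] (mod int p)"
    using e(1) car by (simp_all only: Phi_apply prod.inject cong_def mult_1 power_one_right
      mult_zero_right add_0)
  from a(1) have "1 + q * nat j = 1 + q * nat j'" by (simp only: mod_less lt j)
  then show "j = j'" using j q_gt_1 by auto
  have "[u = u'] (mod int p)" "[v = v'] (mod int p)"
    using a(2,3) by (simp_all only: cong_mult_lcancel[OF coprime_r_minus_1])
  then have "u = u'" "v = v'" using m by (simp_all add: mm cong_def)
  then show "m = m'" by (simp add: mm)
  show "A = A'"
    using e(2,3) car Mat_entry[OF A(1)] Mat_entry[OF A(2)]
    by (intro Mat_eqI[OF A]) (simp_all add: Phi_apply)
qed

text \<open>An element of order dividing \<open>p\<close> has trivial \<open>a\<close>-component, because \<open>p\<close> is coprime to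
  \<open>q\<^sup>2\<close>; hence the normal factor is characteristic.\<close>

lemma auto_preserves_V:
  assumes f: "f \<in> auto M" and xy: "(x, y) \<in> carrier V"
  shows "fst (f (0, x, y)) = 0"
proof -
  interpret f: group_hom M M f
    by unfold_locales (rule autoD(1)[OF f])
  have c: "(0, x, y) \<in> carrier M" using xy by simp
  have "f (0, x, y) [^]\<^bsub>M\<^esub> p = f ((0, x, y) [^]\<^bsub>M\<^esub> p)"
    by (rule f.hom_nat_pow[OF c, symmetric])
  also have "\<dots> = (0, 0, 0)" using f.hom_one by (simp add: pow_M_N one_M)
  finally have "p * fst (f (0, x, y)) mod q ^ 2 = 0" by (simp flip: fst_pow_M)
  then have "q ^ 2 dvd p * fst (f (0, x, y))" by auto
  moreover have "coprime (q ^ 2) p"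
    using primes_coprime[OF prime_q prime_p] p_neq_q by simp
  ultimately have "q ^ 2 dvd fst (f (0, x, y))" by (simp add: coprime_dvd_mult_right_iff)
  moreover have "fst (f (0, x, y)) < q ^ 2"
    using f.hom_closed[OF c] by (cases "f (0, x, y)") simp
  ultimately show ?thesis by (metis dvd_imp_le linorder_not_le neq0_conv)
qed

text \<open>The normal factor is preserved, so \<open>f\<close> acts on it by some matrix. The image \<open>a\<^sup>k n\<close> of \<open>a\<close> must
  act on the normal factor as \<open>a\<close> does, because scalars commute with every matrix; hence
  \<open>r ^ k = r\<close> and \<open>k = 1 + q s\<close>.\<close>

lemma auto_is_Phi:
  assumes f: "f \<in> auto M"
  obtains m A j where "m \<in> carrier V" "A \<in> carrier Mat" "j \<in> carrier Zq"
    "\<And>X. X \<in> carrier M \<Longrightarrow> f X = Phi (m, A, j) X"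
proof -
  interpret f: group_hom M M f
    by unfold_locales (rule autoD(1)[OF f])
  have car: "(1, 0, 0) \<in> carrier M" "(0, 1, 0) \<in> carrier M" "(0, 0, 1) \<in> carrier M"
    using p_gt_1 q2_gt_1 by auto
  obtain a c where fb: "f (0, 1, 0) = (0, a, c)"
    using auto_preserves_V[OF f, of 1 0] p_gt_1 by (cases "f (0, 1, 0)") auto
  obtain b d where fc: "f (0, 0, 1) = (0, b, d)"
    using auto_preserves_V[OF f, of 0 1] p_gt_1 by (cases "f (0, 0, 1)") auto
  obtain k w w' where fa: "f (1, 0, 0) = (k, w, w')" by (cases "f (1, 0, 0)")
  have ac: "(a, c) \<in> carrier V" "(0, a, c) \<in> carrier M" using f.hom_closed[OF car(2)] by (simp_all add: fb)
  have bd: "(b, d) \<in> carrier V" "(0, b, d) \<in> carrier M" using f.hom_closed[OF car(3)] by (simp_all add: fc)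
  have kw: "k < q ^ 2" "(w, w') \<in> carrier V" "(k, w, w') \<in> carrier M"
    using f.hom_closed[OF car(1), unfolded fa] by simp_all
  have fN: "f ((0, 1, 0) [^]\<^bsub>M\<^esub> x \<otimes>\<^bsub>M\<^esub> (0, 0, 1) [^]\<^bsub>M\<^esub> y) =
      (0, (a * x + b * y) mod int p, (c * x + d * y) mod int p)" for x y :: int
  proof -
    have "f ((0, 1, 0) [^]\<^bsub>M\<^esub> x \<otimes>\<^bsub>M\<^esub> (0, 0, 1) [^]\<^bsub>M\<^esub> y) =
        (0, a, c) [^]\<^bsub>M\<^esub> x \<otimes>\<^bsub>M\<^esub> (0, b, d) [^]\<^bsub>M\<^esub> y"
      using car by (simp only: f.hom_mult M.int_pow_closed f.hom_int_pow fb fc)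
    also have "\<dots> = (0, (a * x + b * y) mod int p, (c * x + d * y) mod int p)"
      using ac bd by (simp add: int_pow_M_N mod_simps mult.commute)
    finally show ?thesis .
  qed
  \<comment> \<open>Apply \<open>f\<close> to \<open>b a = a b\<^sup>r\<close>; one entry of the column \<open>f b\<close> can be cancelled, as it is nonzero.\<close>
  have rk: "[r ^ k = r] (mod int p)"
  proof -
    have "(0, 1, 0) \<otimes>\<^bsub>M\<^esub> (1, 0, 0) = (1, 0, 0) \<otimes>\<^bsub>M\<^esub> ((0, 1, 0) [^]\<^bsub>M\<^esub> r \<otimes>\<^bsub>M\<^esub> (0, 0, 1) [^]\<^bsub>M\<^esub> (0 :: int))"
      using p_gt_1 by (simp add: int_pow_M_N one_M)
    then have "f (0, 1, 0) \<otimes>\<^bsub>M\<^esub> f (1, 0, 0) =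
        f (1, 0, 0) \<otimes>\<^bsub>M\<^esub> f ((0, 1, 0) [^]\<^bsub>M\<^esub> r \<otimes>\<^bsub>M\<^esub> (0, 0, 1) [^]\<^bsub>M\<^esub> (0 :: int))"
      using car by (metis f.hom_mult M.int_pow_closed M.m_closed)
    then have "(0, a, c) \<otimes>\<^bsub>M\<^esub> (k, w, w') =
        (k, w, w') \<otimes>\<^bsub>M\<^esub> (0, (a * r + b * 0) mod int p, (c * r + d * 0) mod int p)"
      by (simp only: fa fb fN)
    then have "[r ^ k * a + w = r * a + w] (mod int p)" "[r ^ k * c + w' = r * c + w'] (mod int p)"
      by (simp_all add: cong_def mod_simps algebra_simps)
    then have d: "int p dvd (r ^ k - r) * a" "int p dvd (r ^ k - r) * c"
      by (simp_all add: cong_iff_dvd_diff left_diff_distrib)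
    have "(0, a, c) \<noteq> (0, 0, 0)"
    proof
      assume "(0, a, c) = (0, 0, 0)"
      then have "f (0, 1, 0) = f (0, 0, 0)" using f.hom_one by (simp add: fb one_M)
      then show False
        using autoD(3)[OF f] car M.one_closed
        by (auto simp: bij_betw_def one_M dest: inj_onD)
    qed
    then have "\<not> int p dvd a \<or> \<not> int p dvd c"
      using ac by (auto dest: zdvd_imp_le)
    then show ?thesis
      using d prime_p by (auto simp: prime_dvd_mult_iff cong_iff_dvd_diff)
  qed
  from r_pow_eq_r[OF rk] obtain t where t: "k + q - 1 = q * t" by (elim dvdE)
  then obtain s where s: "t = Suc s" using q_gt_1 by (cases t) auto
  then have k: "k = 1 + q * s" using t q_gt_1 by simp
  have "q * s < q * q" using kw(1) k unfolding power2_eq_square by linarith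
  then have sq: "int s \<in> carrier Zq" using q_gt_1 by simp
  obtain z where z: "[(r - 1) * z = 1] (mod int p)"
    using cong_solve_coprime_int[OF coprime_r_minus_1] by blast
  define m where "m = ((z * w) mod int p, (z * w') mod int p)"
  have m: "m \<in> carrier V" by (simp add: m_def)
  have solve: "[(r - 1) * ((z * w) mod int p) = w] (mod int p)" for w
  proof -
    have "[(r - 1) * ((z * w) mod int p) = (r - 1) * (z * w)] (mod int p)"
      by (intro cong_mult cong_refl) (simp add: cong_def)
    also have "(r - 1) * (z * w) = (r - 1) * z * w" by simp
    also have "[\<dots> = 1 * w] (mod int p)" by (intro cong_mult z cong_refl)
    finally show ?thesis by simp
  qed
  have pw: "(k, w, w') [^]\<^bsub>M\<^esub> i = (i * k mod q ^ 2, ((r ^ i - 1) * fst m) mod int p,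
      ((r ^ i - 1) * snd m) mod int p)" for i :: nat
  proof (induction i)
    case (Suc i)
    have e: "(r ^ k * ((r ^ i - 1) * u mod int p) + W) mod int p = (r ^ Suc i - 1) * u mod int p"
      if "[(r - 1) * u = W] (mod int p)" for u W
    proof -
      have "[r ^ k * ((r ^ i - 1) * u mod int p) + W = r * ((r ^ i - 1) * u) + (r - 1) * u] (mod int p)"
        by (intro cong_add cong_mult rk cong_sym[OF that]) (simp add: cong_def)
      then show ?thesis by (simp add: cong_def algebra_simps)
    qed
    have "(k, w, w') [^]\<^bsub>M\<^esub> Suc i = ((i * k mod q ^ 2 + k) mod q ^ 2,
        (r ^ k * ((r ^ i - 1) * fst m mod int p) + w) mod int p,
        (r ^ k * ((r ^ i - 1) * snd m mod int p) + w') mod int p)"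
      by (simp only: M.nat_pow_Suc Suc mult_M)
    then show ?case
      using e[of "fst m" w] e[of "snd m" w'] solve
      by (simp add: m_def mod_simps add.commute)
  qed (simp add: one_M)
  show thesis
  proof (rule that[of m "mat2 a b c d" "int s"])
    fix X assume X: "X \<in> carrier M"
    obtain i x y where X': "X = (i, x, y)" by (cases X)
    have "f X = f (1, 0, 0) [^]\<^bsub>M\<^esub> i \<otimes>\<^bsub>M\<^esub> f ((0, 1, 0) [^]\<^bsub>M\<^esub> x \<otimes>\<^bsub>M\<^esub> (0, 0, 1) [^]\<^bsub>M\<^esub> y)"
      unfolding M_decompose[OF X[unfolded X'], folded X']
      using car by (simp only: f.hom_mult f.hom_nat_pow M.nat_pow_closed M.int_pow_closed M.m_closed)
    also have "\<dots> = (i * k mod q ^ 2,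
        ((r ^ i - 1) * fst m + (a * x + b * y)) mod int p,
        ((r ^ i - 1) * snd m + (c * x + d * y)) mod int p)"
      unfolding fa fN pw by (simp add: mod_simps)
    also have "\<dots> = Phi (m, mat2 a b c d, int s) X"
      using X unfolding X' by (cases m) (simp add: Phi_apply k add.commute)
    finally show "f X = Phi (m, mat2 a b c d, int s) X" .
  qed (use m sq mat2_in_Mat ac bd in auto)
qed

text \<open>For surjectivity, both an automorphism and its inverse have parameters; the composition law
  and the uniqueness of parameters then make the two matrices inverse to each other.\<close>

lemma Aut_model_iso: "AutoGroup M \<cong> semidirect_product V (GLp \<times>\<times> Zq) GL_action"
proof -
  let ?S = "semidirect_product V (GLp \<times>\<times> Zq) GL_action"
  have S: "group ?S" by (rule group_semidirect_product[OF group_V group_GL_Zq GL_action_hom])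
  interpret S: group ?S by (rule S)
  interpret Mat: monoid Mat by (rule monoid_Mat)
  have car: "(m, A, j) \<in> carrier ?S \<longleftrightarrow> m \<in> carrier V \<and> A \<in> Units Mat \<and> j \<in> carrier Zq" for m A j
    by (simp add: semidirect_product_def GL_sel)
  have mult: "(m', A', j') \<otimes>\<^bsub>?S\<^esub> (m, A, j) = (m' \<otimes>\<^bsub>V\<^esub> act A' m, A' \<otimes>\<^bsub>Mat\<^esub> A, (j' + j) mod int q)"
    if "m \<in> carrier V" for m m' A A' j j'
    using that by (simp add: semidirect_product_def GL_action_def GL_sel del: carrier_DirProd)
  have hom: "Phi \<in> hom ?S (AutoGroup M)"
  proof (rule hom_into_AutoGroupI[OF S])
    fix h assume "h \<in> carrier ?S"
    show "Phi h \<in> hom M M" using Phi_hom by (cases h) auto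
    show "Phi h \<in> extensional (carrier M)" by (cases h) (auto simp: Phi_def)
  next
    fix h h' X assume h: "h \<in> carrier ?S" "h' \<in> carrier ?S" and X: "X \<in> carrier M"
    obtain m A j m' A' j' where hh: "h = (m, A, j)" "h' = (m', A', j')" by (metis prod_cases3)
    have c: "m \<in> carrier V" "A \<in> carrier Mat" "0 \<le> j" "m' \<in> carrier V" "A' \<in> carrier Mat" "0 \<le> j'"
      using h by (simp_all add: hh car GL_in_Mat del: carrier_DirProd)
    show "Phi (h \<otimes>\<^bsub>?S\<^esub> h') X = Phi h (Phi h' X)"
      unfolding hh mult[OF c(4)] by (rule Phi_mult[OF c(5,2,6,3) X, symmetric])
  next
    fix X assume "X \<in> carrier M"
    then show "Phi \<one>\<^bsub>?S\<^esub> X = X"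
      using Phi_one by (simp add: semidirect_product_def GL_sel)
  qed
  have inj: "inj_on Phi (carrier ?S)"
  proof (rule inj_onI)
    fix h h' assume h: "h \<in> carrier ?S" "h' \<in> carrier ?S" and eq: "Phi h = Phi h'"
    obtain m A j m' A' j' where hh: "h = (m, A, j)" "h' = (m', A', j')" by (metis prod_cases3)
    have c: "m \<in> carrier V" "A \<in> carrier Mat" "j \<in> carrier Zq"
        "m' \<in> carrier V" "A' \<in> carrier Mat" "j' \<in> carrier Zq"
      using h by (simp_all add: hh car GL_in_Mat del: carrier_DirProd)
    show "h = h'"
      using Phi_inject[OF c(2,5,3,6,1,4)] eq by (simp add: hh)
  qed
  have surj: "auto M \<subseteq> Phi ` carrier ?S"
  proof
    fix f assume f: "f \<in> auto M"
    define g where "g = inv\<^bsub>AutoGroup M\<^esub> f"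
    interpret Aut: group "AutoGroup M" by (rule M.AutoGroup)
    have g: "g \<in> auto M" using Aut.inv_closed f by (simp add: g_def)
    have fg: "f (g X) = X" "g (f X) = X" if "X \<in> carrier M" for X
    proof -
      have "f \<otimes>\<^bsub>AutoGroup M\<^esub> g = \<one>\<^bsub>AutoGroup M\<^esub>" "g \<otimes>\<^bsub>AutoGroup M\<^esub> f = \<one>\<^bsub>AutoGroup M\<^esub>"
        using f by (simp_all add: g_def Aut.r_inv Aut.l_inv)
      from this[THEN fun_cong, of X] show "f (g X) = X" "g (f X) = X"
        using that by (simp_all add: mult_AutoGroup f g one_AutoGroup compose_def)
    qed
    obtain m A j where F: "m \<in> carrier V" "A \<in> carrier Mat" "j \<in> carrier Zq"
        "\<And>X. X \<in> carrier M \<Longrightarrow> f X = Phi (m, A, j) X"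
      using auto_is_Phi[OF f] by blast
    obtain n B l where G: "n \<in> carrier V" "B \<in> carrier Mat" "l \<in> carrier Zq"
        "\<And>X. X \<in> carrier M \<Longrightarrow> g X = Phi (n, B, l) X"
      using auto_is_Phi[OF g] by blast
    have inverse: "B \<otimes>\<^bsub>Mat\<^esub> A = \<one>\<^bsub>Mat\<^esub>"
      if "m \<in> carrier V" "A \<in> carrier Mat" "j \<in> carrier Zq" "n \<in> carrier V" "B \<in> carrier Mat" "l \<in> carrier Zq"
        and comp: "\<And>X. X \<in> carrier M \<Longrightarrow> Phi (n, B, l) (Phi (m, A, j) X) = X" for m A j n B l
    proof (rule Phi_inject(2))
      have nonneg: "0 \<le> j" "0 \<le> l" using that by simp_all
      show "Phi (n \<otimes>\<^bsub>V\<^esub> act B m, B \<otimes>\<^bsub>Mat\<^esub> A, (l + j) mod int q) X = Phi (\<one>\<^bsub>V\<^esub>, \<one>\<^bsub>Mat\<^esub>, 0) X"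
        if "X \<in> carrier M" for X
        using Phi_mult[OF \<open>A \<in> carrier Mat\<close> \<open>B \<in> carrier Mat\<close> nonneg that, of n m] comp[OF that] Phi_one[OF that] by metis
    next
      show "n \<otimes>\<^bsub>V\<^esub> act B m \<in> carrier V"
        using \<open>n \<in> carrier V\<close> act_closed by (rule monoid.m_closed[OF group.is_monoid[OF group_V]])
    qed (use that in \<open>simp_all add: monoid.one_closed[OF group.is_monoid[OF group_V]]\<close>)
    have mem: "Phi (m, A, j) X \<in> carrier M" "Phi (n, B, l) X \<in> carrier M" if "X \<in> carrier M" for X
      using that Phi_closed by (cases m; cases n; simp)+
    have "B \<otimes>\<^bsub>Mat\<^esub> A = \<one>\<^bsub>Mat\<^esub>"
      by (rule inverse[OF F(1-3) G(1-3)]) (use fg F(4) G(4) mem in metis)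
    moreover have "A \<otimes>\<^bsub>Mat\<^esub> B = \<one>\<^bsub>Mat\<^esub>"
      by (rule inverse[OF G(1-3) F(1-3)]) (use fg F(4) G(4) mem in metis)
    ultimately have "(m, A, j) \<in> carrier ?S"
      unfolding car Units_def using F G by auto
    moreover have "f = Phi (m, A, j)"
    proof (rule extensionalityI[OF autoD(2)[OF f]])
      show "Phi (m, A, j) \<in> extensional (carrier M)" by (cases m) (simp add: Phi_def)
    qed (rule F(4))
    ultimately show "f \<in> Phi ` carrier ?S" by blast
  qed
  have "Phi ` carrier ?S = auto M"
    using hom surj by (auto simp: hom_def)
  then have "Phi \<in> iso ?S (AutoGroup M)"
    using hom inj by (simp add: iso_def bij_betw_def)
  then show ?thesis by (rule S.iso_sym[OF is_isoI])
qed

end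

theorem mainTheorem5:
  fixes p q :: nat and r :: int
  assumes "prime p" and "prime q" and "p \<noteq> q" and "p * q \<noteq> 6" and "q dvd p - 1"
    and "[r ^ q = 1] (mod int p)" and "\<not> [r = 1] (mod int p)"
  shows "\<exists>\<phi> \<in> hom (GL 2 (residue_ring (int p)) \<times>\<times> integer_mod_group q)
                  (AutoGroup (integer_mod_group p \<times>\<times> integer_mod_group p)).
           AutoGroup (G_group p q r) \<cong>
           semidirect_product (integer_mod_group p \<times>\<times> integer_mod_group p)
             (GL 2 (residue_ring (int p)) \<times>\<times> integer_mod_group q) \<phi>"
proof -
  interpret scalar_action p q r
    using assms by unfold_locales
  show ?thesis
    using GL_action_hom
      iso_trans[OF AutoGroup_cong[OF group_G_group group_M G_group_iso_model] Aut_model_iso]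
    by blast
qed

end
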